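(* Let $D=((a_n),(b_n))$ be a divisor with $a_n\neq0$, $b_n\neq0$ for all $n$, satisfying: (a) $\inf_{n,k}|a_n-b_k|>0$; (b) there is $C$ with ${\rm card}\{n:|a_n-c|\le 1\}+{\rm card}\{n:|b_n-c|\le1\}<C$ for all $c\in\mathbb{C}$; (d) there is $C$ with $\Big|\int_1^r\frac{{\rm card}\{n:|a_n-c|<t\}-{\rm card}\{n:|b_n-c|<t\}}{t}\,dt\Big|<C$ for all $c\in\mathbb{C}$, $r>1$; (e) there is $C$ with $\Big|\frac1r\int_1^r\Big(\sum_{n:|a_n-c|<t}(a_n-c)-\sum_{n:|b_n-c|<t}(b_n-c)\Big)\frac{dt}{t}\Big|<C$ for all $c\in\mathbb{C}$, $r>1$; (f) $\lim_{r\to\infty}\big(\sum_{1\le|a_n|<r}a_n^{-2}-\sum_{1\le|b_n|<r}b_n^{-2}\big)$ exists and is finite. Then $\alpha=\lim_{r\to\infty}\big(\sum_{|b_n|<r}(1/b_n-\overline{b_n}/r^2)-\sum_{|a_n|<r}(1/a_n-\overline{a_n}/r^2)\big)$ exists, the function $$f(z)=e^{\alpha z}\lim_{r\to\infty}\frac{\prod_{n:|a_n|<r}(1-z/a_n)e^{z/a_n}}{\prod_{n:|b_n|<r}(1-z/b_n)e^{z/b_n}}$$ is well defined and meromorphic on $\mathbb{C}$, it has divisor $D$, and it is a normal function.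
   Context: $\rho_S$ is the spherical metric. A meromorphic $f$ on $\mathbb{C}$ is normal if for every sequence $(h_n)\subset\mathbb{C}$ there is a subsequence $(h_{n'})$ with $\rho_S(f(z+h_{n'}),f(z+h_{m'}))\to0$ uniformly on compact subsets of $\mathbb{C}$. A divisor $D=((a_n),(b_n))$: a map $\mathbb{C}\to\mathbb{Z}$ with discrete support, $(a_n)$ listing the points with positive value (with multiplicity $D(a)$) and $(b_n)$ the points with negative value (with multiplicity $-D(b)$); it is the divisor of $f$ if the $a_n$ are the zeros and $b_n$ the poles of $f$ with multiplicities. *)

theory Defs
  imports "HOL-Analysis.Analysis"
begin

text \<open>A divisor is a map D :: complex \<Rightarrow> int with discrete (locally finite) support.
  Zeros a_n are the points with D > 0 (multiplicity D a), poles b_n those with D < 0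
  (multiplicity -D b).  Sums/counts over the sequences (a_n), (b_n) are written as sums
  over the support weighted by the multiplicity.\<close>

definition is_divisor :: "(complex \<Rightarrow> int) \<Rightarrow> bool" where
  "is_divisor D \<longleftrightarrow> (\<forall>R::real. finite {z. D z \<noteq> 0 \<and> cmod z \<le> R})"

definition meromorphic_with_divisor :: "(complex \<Rightarrow> complex) \<Rightarrow> (complex \<Rightarrow> int) \<Rightarrow> bool" where
  "meromorphic_with_divisor f D \<longleftrightarrow>
     (\<forall>z. \<exists>r>0. \<exists>g. g holomorphic_on ball z r \<and> g z \<noteq> 0 \<and>
        (\<forall>w\<in>ball z r. (w \<noteq> z \<or> D z \<ge> 0) \<longrightarrow> f w = (w - z) powi (D z) * g w))"

text \<open>Chordal (spherical) metric on the Riemann sphere, None = \<infinity>.\<close>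

fun rho_S :: "complex option \<Rightarrow> complex option \<Rightarrow> real" where
  "rho_S (Some a) (Some b) = 2 * cmod (a - b) / (sqrt (1 + (cmod a)\<^sup>2) * sqrt (1 + (cmod b)\<^sup>2))"
| "rho_S (Some a) None = 2 / sqrt (1 + (cmod a)\<^sup>2)"
| "rho_S None (Some b) = 2 / sqrt (1 + (cmod b)\<^sup>2)"
| "rho_S None None = 0"

definition normal_function :: "(complex \<Rightarrow> complex option) \<Rightarrow> bool" where
  "normal_function F \<longleftrightarrow>
     (\<forall>h :: nat \<Rightarrow> complex. \<exists>\<sigma> :: nat \<Rightarrow> nat. strict_mono \<sigma> \<and>
        (\<forall>K. compact K \<longrightarrow> (\<forall>e>0. \<exists>N::nat. \<forall>m\<ge>N. \<forall>n\<ge>N. \<forall>z\<in>K.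
            rho_S (F (z + h (\<sigma> n))) (F (z + h (\<sigma> m))) < e)))"

end

theory Submission
  imports Defs "HOL-Complex_Analysis.Complex_Analysis"
begin

text \<open>Write \<open>\<mu> = \<Sum>\<^sub>w D(w) \<delta>\<^sub>w\<close>. Hypotheses (d) and (e) bound the sums of \<open>D(w)\<close> and \<open>D(w) (w - c)\<close> against the
  kernel \<open>log\<^sup>+ (r / max 1 \<bar>w - c\<bar>)\<close>, uniformly in \<open>c\<close>. Superpositions of these kernels over \<open>r\<close> bound
  all the radial sums that occur. In particular (e) makes
  \<open>\<Sum> D(w) cnj (w - x) (1 / max \<bar>w - x\<bar> R ^ 2 - 1 / r ^ 2)\<close> of size \<open>O(1 / R)\<close>, uniformly in \<open>x\<close> and \<open>r\<close>.
  At \<open>x = 0\<close> this is a Cauchy estimate that gives the limit \<open>\<alpha>\<close>. For general \<open>x\<close> it says that \<open>log \<bar>f\<bar>\<close>,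
  averaged over discs of radius \<open>R\<close>, has gradient \<open>O(1 / R)\<close>, so that with \<open>R\<close> comparable to \<open>\<bar>c\<bar>\<close> the averages
  around \<open>c\<close> and around \<open>0\<close> differ by \<open>O(1)\<close>. By (d) the average around \<open>c\<close> differs from \<open>log \<bar>f(c)\<bar>\<close> only by the
  logarithmic contribution of the points of the divisor in the unit disc around \<open>c\<close>, up to \<open>O(1)\<close>.
  Hence \<open>f\<close> is uniformly bounded away from its poles and \<open>1 / f\<close> away from the zeros; since zeros and poles
  are separated by (a), \<open>f\<close> is uniformly Lipschitz for the spherical metric, and the Arzela--Ascoli theorem
  yields normality. Convergence of the product needs (f) for the quadratic terms only: by (b) the
  cubic terms are absolutely summable.\<close>

section \<open>Kernels\<close>

text \<open>For s >= 1 this is the integral of 1 / t over those t in [1, s] that exceed x. It is the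
  weight that (d) and (e) give to a point at distance x from c; the inner \<open>max 1 x\<close>
  reflects that those integrals start at t = 1.\<close>

definition log_cutoff :: "real \<Rightarrow> real \<Rightarrow> real" where
  "log_cutoff s x = ln (max 1 (s / max 1 x))"

lemma log_cutoff_less: "x < s \<Longrightarrow> 1 \<le> s \<Longrightarrow> log_cutoff s x = ln (s / max 1 x)"
proof -
  assume "x < s" "1 \<le> s"
  then have "1 \<le> s / max 1 x" by simp
  then show ?thesis by (simp add: log_cutoff_def)
qed

lemma log_cutoff_eq_0: "s \<le> x \<or> s \<le> 1 \<Longrightarrow> log_cutoff s x = 0"
proof -
  assume "s \<le> x \<or> s \<le> 1"
  then have "s / max 1 x \<le> 1" by (subst divide_le_eq) auto
  then show ?thesis by (simp add: log_cutoff_def)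
qed

lemma log_cutoff_nonneg: "0 \<le> log_cutoff s x"
  by (simp add: log_cutoff_def)

text \<open>Up to \<open>max 1 x\<close> the kernel is zero and beyond it is a plain logarithm, so
  both endpoints may be moved up to \<open>max 1 x\<close> before the antiderivative is evaluated.
  The weight \<theta> is left open because two different superpositions are needed.\<close>

lemma log_cutoff_has_integral:
  assumes "1 \<le> a" "a \<le> b"
    and G: "\<And>s. 1 \<le> s \<Longrightarrow> (G has_real_derivative \<theta> s * ln (s / max 1 x)) (at s)"
  shows "((\<lambda>s. \<theta> s * log_cutoff s x) has_integral (G (max b (max 1 x)) - G (max a (max 1 x)))) {a..b}"
proof -
  define \<tau> where "\<tau> = max 1 x"
  have zero: "((\<lambda>s. \<theta> s * log_cutoff s x) has_integral 0) {p..q}" if "q \<le> \<tau>" for p q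
    using that by (intro has_integral_is_0) (auto simp: \<tau>_def log_cutoff_eq_0 le_max_iff_disj)
  have pos: "((\<lambda>s. \<theta> s * log_cutoff s x) has_integral (G q - G p)) {p..q}" if "\<tau> \<le> p" "p \<le> q" for p q
  proof (rule fundamental_theorem_of_calculus[OF that(2)])
    fix s assume s: "s \<in> {p..q}"
    then have "1 \<le> s" "x \<le> s" using that by (auto simp: \<tau>_def)
    then have "1 \<le> s / max 1 x" by simp
    then have "max 1 (s / max 1 x) = s / max 1 x" by simp
    then have "log_cutoff s x = ln (s / max 1 x)"
      by (simp add: log_cutoff_def)
    with G[OF \<open>1 \<le> s\<close>]
    show "(G has_vector_derivative \<theta> s * log_cutoff s x) (at s within {p..q})"
      by (simp add: has_real_derivative_iff_has_vector_derivative has_vector_derivative_at_within)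
  qed
  consider "b \<le> \<tau>" | "\<tau> \<le> a" | "a < \<tau>" "\<tau> < b" by linarith
  then show ?thesis
    unfolding \<tau>_def[symmetric]
  proof cases
    case 3
    have "((\<lambda>s. \<theta> s * log_cutoff s x) has_integral (0 + (G b - G \<tau>))) {a..b}"
      using 3 by (intro has_integral_combine[OF _ _ zero pos]) auto
    with 3 show "((\<lambda>s. \<theta> s * log_cutoff s x) has_integral (G (max b \<tau>) - G (max a \<tau>))) {a..b}"
      by (simp add: max_absorb1 max_absorb2)
  qed (use zero[of b a] pos[of a b] assms(2) in \<open>auto simp: max_absorb1 max_absorb2\<close>)
qed

lemma log_cutoff_has_integral_inverse:
  assumes "1 \<le> r"
  shows "((\<lambda>t. if x < t then 1 / t else 0) has_integral log_cutoff r x) {1..r}"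
proof (cases "r \<le> x")
  case True
  then show ?thesis
    by (auto intro!: has_integral_is_0 simp: log_cutoff_eq_0)
next
  case False
  define \<tau> where "\<tau> = max 1 x"
  have \<tau>: "1 \<le> \<tau>" "\<tau> \<le> r" using False assms by (auto simp: \<tau>_def)
  have A: "((\<lambda>t. if x < t then 1 / t else 0) has_integral 0) {1..\<tau>}"
    by (rule has_integral_spike_finite[of "{1}" _ _ "\<lambda>_. 0"]) (auto simp: \<tau>_def max_def split: if_splits)
  have "((\<lambda>t. 1 / t) has_integral (ln r - ln \<tau>)) {\<tau>..r}"
    using \<tau> by (intro fundamental_theorem_of_calculus)
      (auto intro!: derivative_eq_intros simp flip: has_real_derivative_iff_has_vector_derivative)
  then have B: "((\<lambda>t. if x < t then 1 / t else 0) has_integral (ln r - ln \<tau>)) {\<tau>..r}"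
    by (rule has_integral_spike_finite[of "{\<tau>}" _ _ "\<lambda>t. 1 / t", rotated 2]) (auto simp: \<tau>_def)
  have "log_cutoff r x = ln r - ln \<tau>"
    using False assms \<tau> by (simp add: log_cutoff_less \<tau>_def ln_div)
  with has_integral_combine[OF \<tau> A B] show ?thesis by simp
qed

text \<open>The weight 4 / s^3 has the antiderivative -2 ln (s / \<tau>) / s^2 - 1 / s^2. Its
  non-logarithmic part produces the kernel 1 / max x R ^ 2 - 1 / r ^ 2; the boundary terms are again
  multiples of \<open>log_cutoff\<close>, so (e) controls them as well.\<close>

lemma log_cutoff_has_integral_cubic:
  assumes "1 \<le> R" "R \<le> r" "x \<le> r"
  shows "((\<lambda>s. 4 / s ^ 3 * log_cutoff s x) has_integral
     (1 / (max x R)\<^sup>2 - 1 / r\<^sup>2 - 2 / r\<^sup>2 * log_cutoff r x + 2 / R\<^sup>2 * log_cutoff R x)) {R..r}"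
proof -
  define \<tau> where "\<tau> = max 1 x"
  have \<tau>: "0 < \<tau>" by (simp add: \<tau>_def)
  define lg where "lg s = ln (s / \<tau>)" for s
  define G where "G = (\<lambda>s. - 2 / s\<^sup>2 * lg s - 1 / s\<^sup>2)"
  have "(G has_real_derivative 4 / s ^ 3 * ln (s / max 1 x)) (at s)" if "1 \<le> s" for s
  proof -
    have L: "(lg has_real_derivative 1 / s) (at s)"
      unfolding lg_def using that \<tau> by (auto intro!: derivative_eq_intros)
    have "(G has_real_derivative - 2 / s\<^sup>2 * (1 / s) + 4 / s ^ 3 * lg s + 2 / s ^ 3) (at s)"
      unfolding G_def using that
      by (auto intro!: derivative_eq_intros L simp: field_simps power2_eq_square power3_eq_cube)
    then show ?thesis
      unfolding lg_def \<tau>_def by (simp add: power2_eq_square power3_eq_cube)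
  qed
  note * = log_cutoff_has_integral[of R r G, OF assms(1,2) this]
  have 1: "max r (max 1 x) = r" "max R (max 1 x) = max x R" using assms by auto
  have 2: "log_cutoff r x = ln (r / \<tau>)"
    using assms 1 by (cases "x < r") (simp_all add: log_cutoff_less log_cutoff_eq_0 \<tau>_def)
  \<comment> \<open>If R <= x then \<open>max x R = \<tau>\<close>, since 1 <= R, and both
    logarithms vanish.\<close>
  have 3: "2 / (max x R)\<^sup>2 * ln (max x R / \<tau>) = 2 / R\<^sup>2 * log_cutoff R x"
    using assms by (cases "x < R") (simp_all add: log_cutoff_less log_cutoff_eq_0 \<tau>_def)
  have "G (max r (max 1 x)) - G (max R (max 1 x)) =
     1 / (max x R)\<^sup>2 - 1 / r\<^sup>2 - 2 / r\<^sup>2 * log_cutoff r x + 2 / R\<^sup>2 * log_cutoff R x"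
    unfolding 1 G_def lg_def 2 3[symmetric] by simp
  with * show ?thesis by simp
qed

text \<open>The same device with a growing weight, which yields the quadratic kernel R^2 - x^2. Here
  x appears as \<open>max 1 x\<close> because \<open>log_cutoff\<close> is constant on the unit
  disc.\<close>

lemma log_cutoff_has_integral_linear:
  assumes "1 \<le> R" "x \<le> R"
  shows "((\<lambda>s. 4 * s * log_cutoff s x) has_integral
     (2 * R\<^sup>2 * log_cutoff R x - (R\<^sup>2 - (max 1 x)\<^sup>2))) {1..R}"
proof -
  define \<tau> where "\<tau> = max 1 x"
  have \<tau>: "0 < \<tau>" by (simp add: \<tau>_def)
  define lg where "lg s = ln (s / \<tau>)" for s
  define G where "G = (\<lambda>s. 2 * s\<^sup>2 * lg s - s\<^sup>2)"
  have "(G has_real_derivative 4 * s * ln (s / max 1 x)) (at s)" if "1 \<le> s" for s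
  proof -
    have L: "(lg has_real_derivative 1 / s) (at s)"
      unfolding lg_def using that \<tau> by (auto intro!: derivative_eq_intros)
    have "(G has_real_derivative 2 * s\<^sup>2 * (1 / s) + 4 * s * lg s - 2 * s) (at s)"
      unfolding G_def using that by (auto intro!: derivative_eq_intros L)
    then show ?thesis
      using that unfolding lg_def \<tau>_def by (simp add: power2_eq_square)
  qed
  note * = log_cutoff_has_integral[of 1 R G, OF _ assms(1) this]
  have 1: "max R (max 1 x) = R" "max 1 (max 1 x) = \<tau>" using assms by (auto simp: \<tau>_def)
  have 2: "log_cutoff R x = ln (R / \<tau>)"
    using assms 1 by (cases "x < R") (simp_all add: log_cutoff_less log_cutoff_eq_0 \<tau>_def)
  have "\<tau> \<ge> 1" by (simp add: \<tau>_def)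
  then have "G (max R (max 1 x)) - G (max 1 (max 1 x)) = 2 * R\<^sup>2 * log_cutoff R x - (R\<^sup>2 - (max 1 x)\<^sup>2)"
    unfolding 1 G_def lg_def 2 by (simp add: \<tau>_def)
  with * show ?thesis by simp
qed

text \<open>A finite sum commutes with the integral over the scale s, so a bound that holds at each
  scale integrates to a bound for the superposed kernel. This is how (d) and (e) are transferred to
  other radial sums.\<close>

lemma norm_sum_superposition_le:
  fixes g :: "'a \<Rightarrow> complex" and k :: "'a \<Rightarrow> real \<Rightarrow> real"
  assumes "finite A"
    and k: "\<And>w. w \<in> A \<Longrightarrow> (k w has_integral I w) {a..b}"
    and B: "\<And>s. s \<in> {a..b} \<Longrightarrow> cmod (\<Sum>w\<in>A. g w * k w s) \<le> B s"
    and J: "(B has_integral J) {a..b}"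
  shows "cmod (\<Sum>w\<in>A. g w * I w) \<le> J"
proof -
  have *: "((\<lambda>s. \<Sum>w\<in>A. g w * k w s) has_integral (\<Sum>w\<in>A. g w * I w)) {a..b}"
    using k by (intro has_integral_sum assms(1) has_integral_mult_right has_integral_of_real)
  from * have "cmod (integral {a..b} (\<lambda>s. \<Sum>w\<in>A. g w * k w s)) \<le> integral {a..b} B"
    using J B by (intro integral_norm_bound_integral has_integral_integrable) auto
  then show ?thesis
    using integral_unique[OF *] integral_unique[OF J] by simp
qed

text \<open>For d = |w - c| and R > 0, \<open>smooth_log R (d\<^sup>2)\<close> is the mean of ln |z
  - w| over z in the disc of radius R around c. Using the squared distance as argument keeps it
  differentiable at d = 0.\<close>

definition smooth_log :: "real \<Rightarrow> real \<Rightarrow> real" where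
  "smooth_log R s = (if R\<^sup>2 \<le> s then ln s / 2 else ln R + (s / R\<^sup>2 - 1) / 2)"

lemma smooth_log_deriv:
  assumes "0 < R"
  shows "(smooth_log R has_real_derivative 1 / (2 * max s (R\<^sup>2))) (at s)"
proof -
  let ?f = "\<lambda>s. ln s / 2" and ?g = "\<lambda>s. ln R + (s / R\<^sup>2 - 1) / 2"
  have R2: "0 < R\<^sup>2" using assms by simp
  have f: "(?f has_real_derivative 1 / (2 * s)) (at s)" if "0 < s" for s
    using that by (auto intro!: derivative_eq_intros)
  have g: "(?g has_real_derivative 1 / (2 * R\<^sup>2)) (at s)" for s
    using R2 by (auto intro!: derivative_eq_intros simp: field_simps power2_eq_square)
  consider "s < R\<^sup>2" | "R\<^sup>2 < s" | "s = R\<^sup>2" by linarith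
  then show ?thesis
  proof cases
    case 1
    then have "eventually (\<lambda>t. t < R\<^sup>2) (nhds s)" by (intro eventually_nhds_in_open[of "{..<R\<^sup>2}", simplified])
    then have "eventually (\<lambda>t. smooth_log R t = ?g t) (nhds s)"
      by eventually_elim (simp add: smooth_log_def)
    with 1 g[of s] show ?thesis
      by (subst DERIV_cong_ev[OF refl _ refl]) (auto simp: max_absorb2)
  next
    case 2
    then have "eventually (\<lambda>t. R\<^sup>2 < t) (nhds s)" by (intro eventually_nhds_in_open[of "{R\<^sup>2<..}", simplified])
    then have "eventually (\<lambda>t. smooth_log R t = ?f t) (nhds s)"
      by eventually_elim (simp add: smooth_log_def)
    with 2 f[of s] R2 show ?thesis
      by (subst DERIV_cong_ev[OF refl _ refl]) (auto simp: max_absorb1)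
  next
    case 3
    \<comment> \<open>At the junction both branches have the same value and the same slope 1 / (2
      R^2), so each one-sided difference quotient can be computed on its own branch.\<close>
    have eq: "smooth_log R s = ?f s" "smooth_log R s = ?g s"
      using 3 assms by (simp_all add: smooth_log_def ln_realpow)
    have "((\<lambda>t. (smooth_log R t - smooth_log R s) / (t - s)) \<longlongrightarrow> 1 / (2 * R\<^sup>2)) (at s)"
    proof (rule filterlim_split_at)
      have "((\<lambda>t. (?g t - ?g s) / (t - s)) \<longlongrightarrow> 1 / (2 * R\<^sup>2)) (at s)"
        using g[of s] by (simp only: has_field_derivative_iff)
      then have "((\<lambda>t. (?g t - ?g s) / (t - s)) \<longlongrightarrow> 1 / (2 * R\<^sup>2)) (at_left s)"
        by (rule tendsto_within_subset) simp
      moreover have "(?g t - ?g s) / (t - s) = (smooth_log R t - smooth_log R s) / (t - s)" if "t < s" for t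
        unfolding eq(2) using that by (simp add: smooth_log_def 3)
      then have "eventually (\<lambda>t. (?g t - ?g s) / (t - s) = (smooth_log R t - smooth_log R s) / (t - s)) (at_left s)"
        unfolding eventually_at_filter by (intro always_eventually) blast
      ultimately show "((\<lambda>t. (smooth_log R t - smooth_log R s) / (t - s)) \<longlongrightarrow> 1 / (2 * R\<^sup>2)) (at_left s)"
        by (rule Lim_transform_eventually)
    next
      have "((\<lambda>t. (?f t - ?f s) / (t - s)) \<longlongrightarrow> 1 / (2 * R\<^sup>2)) (at s)"
        using f[of s] R2 unfolding 3 by (simp only: has_field_derivative_iff)
      then have "((\<lambda>t. (?f t - ?f s) / (t - s)) \<longlongrightarrow> 1 / (2 * R\<^sup>2)) (at_right s)"
        by (rule tendsto_within_subset) simp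
      moreover have "(?f t - ?f s) / (t - s) = (smooth_log R t - smooth_log R s) / (t - s)" if "s < t" for t
        unfolding eq(1) using that by (simp add: smooth_log_def 3)
      then have "eventually (\<lambda>t. (?f t - ?f s) / (t - s) = (smooth_log R t - smooth_log R s) / (t - s)) (at_right s)"
        unfolding eventually_at_filter by (intro always_eventually) (blast intro: less_le_trans)
      ultimately show "((\<lambda>t. (smooth_log R t - smooth_log R s) / (t - s)) \<longlongrightarrow> 1 / (2 * R\<^sup>2)) (at_right s)"
        by (rule Lim_transform_eventually)
    qed
    then show ?thesis by (simp add: has_field_derivative_iff 3)
  qed
qed

text \<open>The derivative of the remainder is -z^2 / (1 - z), which has norm at most 2 |u|^2 on the
  disc |z| <= |u|; the mean value inequality contributes the third factor |u|.\<close>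

lemma Ln_taylor_bound:
  assumes "cmod u \<le> 1 / 2"
  shows "cmod (Ln (1 - u) + u + u\<^sup>2 / 2) \<le> 2 * cmod u ^ 3"
proof -
  let ?h = "\<lambda>u. Ln (1 - u) + u + u\<^sup>2 / 2"
  have "cmod (?h u - ?h 0) \<le> 2 * (cmod u)\<^sup>2 * cmod (u - 0)"
  proof (rule field_differentiable_bound[where S = "cball 0 (cmod u)" and f' = "\<lambda>z. - z\<^sup>2 / (1 - z)"])
    fix z :: complex assume "z \<in> cball 0 (cmod u)"
    then have z: "cmod z \<le> cmod u" "cmod z \<le> 1 / 2" using assms by auto
    have "1 - cmod z \<le> cmod (1 - z)" using norm_triangle_ineq2[of 1 z] by simp
    then have z1: "1 / 2 \<le> cmod (1 - z)" using z by linarith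
    then have "1 - z \<noteq> 0" by auto
    have "Re z \<le> cmod z" by (rule complex_Re_le_cmod)
    then have "1 - z \<notin> \<real>\<^sub>\<le>\<^sub>0" using z by (auto simp: complex_nonpos_Reals_iff)
    then have "(?h has_field_derivative - 1 / (1 - z) + 1 + z) (at z)"
      by (auto intro!: derivative_eq_intros simp: field_simps)
    also have "- 1 / (1 - z) + 1 + z = - z\<^sup>2 / (1 - z)"
      using \<open>1 - z \<noteq> 0\<close> by (simp add: field_simps power2_eq_square)
    finally show "(?h has_field_derivative - z\<^sup>2 / (1 - z)) (at z within cball 0 (cmod u))"
      by (rule has_field_derivative_at_within)
    have "cmod (- z\<^sup>2 / (1 - z)) \<le> (cmod u)\<^sup>2 / (1 / 2)"
      unfolding norm_divide norm_minus_cancel norm_power using z z1 by (intro frac_le power_mono) auto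
    then show "cmod (- z\<^sup>2 / (1 - z)) \<le> 2 * (cmod u)\<^sup>2" by simp
  qed auto
  then show ?thesis by (simp add: power2_eq_square power3_eq_cube)
qed

text \<open>Weierstrass's elementary factor of genus one with its zero at \<open>w\<close>.\<close>

definition elementary_factor :: "complex \<Rightarrow> complex \<Rightarrow> complex" where
  "elementary_factor w z = (1 - z / w) * exp (z / w)"

section \<open>A criterion for normality\<close>

lemma divisor_isolated:
  assumes "is_divisor D"
  obtains s where "0 < s" "\<And>w. w \<in> ball z s \<Longrightarrow> w \<noteq> z \<Longrightarrow> D w = 0"
proof -
  have "finite ({w. D w \<noteq> 0 \<and> cmod w \<le> cmod z + 1} - {z})"
    using assms by (simp add: is_divisor_def)
  then obtain d where d: "0 < d" "\<And>w. w \<in> {w. D w \<noteq> 0 \<and> cmod w \<le> cmod z + 1} - {z} \<Longrightarrow> d \<le> dist z w"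
    using finite_set_avoid[of "{w. D w \<noteq> 0 \<and> cmod w \<le> cmod z + 1} - {z}" z] by blast
  show thesis
  proof (rule that[of "min d 1"])
    fix w assume w: "w \<in> ball z (min d 1)" "w \<noteq> z"
    have "cmod w \<le> cmod z + cmod (z - w)" using norm_triangle_ineq4[of z "z - w"] by simp
    with w have "cmod w \<le> cmod z + 1" by (simp add: dist_norm)
    with d(2)[of w] w show "D w = 0" by force
  qed (use d in auto)
qed

lemma holomorphic_if_divisor_nonneg:
  assumes "meromorphic_with_divisor f D" "open S" "\<And>z. z \<in> S \<Longrightarrow> 0 \<le> D z"
  shows "f holomorphic_on S"
proof -
  have "f field_differentiable at z" if "z \<in> S" for z
  proof -
    obtain r g where r: "0 < r" "g holomorphic_on ball z r"
      and f: "\<forall>w\<in>ball z r. (w \<noteq> z \<or> D z \<ge> 0) \<longrightarrow> f w = (w - z) powi (D z) * g w"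
      using assms(1) unfolding meromorphic_with_divisor_def by blast
    have "(\<lambda>w. (w - z) ^ nat (D z) * g w) holomorphic_on ball z r"
      by (intro holomorphic_intros r)
    also have "?this \<longleftrightarrow> f holomorphic_on ball z r"
      using f assms(3)[OF that] by (intro holomorphic_cong) (auto simp: power_int_def)
    finally show ?thesis
      using r(1) holomorphic_on_imp_differentiable_at[of f "ball z r" z] by simp
  qed
  then show ?thesis
    by (simp add: holomorphic_on_def field_differentiable_at_within)
qed

text \<open>\<open>meromorphic_with_divisor\<close> leaves the value of \<open>f\<close> at a pole
  unspecified, so the reciprocal must be given its value 0 there explicitly. Elsewhere the local
  factorisation is simply inverted.\<close>

lemma reciprocal_meromorphic_with_divisor:
  assumes "meromorphic_with_divisor f D" "is_divisor D"
  shows "meromorphic_with_divisor (\<lambda>z. if D z < 0 then 0 else inverse (f z)) (\<lambda>z. - D z)"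
  unfolding meromorphic_with_divisor_def
proof
  fix z
  obtain r g where r: "0 < r" "g holomorphic_on ball z r" "g z \<noteq> 0"
    and f: "\<forall>w\<in>ball z r. (w \<noteq> z \<or> D z \<ge> 0) \<longrightarrow> f w = (w - z) powi (D z) * g w"
    using assms(1) unfolding meromorphic_with_divisor_def by blast
  obtain s where s: "0 < s" "\<And>w. w \<in> ball z s \<Longrightarrow> w \<noteq> z \<Longrightarrow> D w = 0"
    using divisor_isolated[OF assms(2)] by blast
  have "isCont g z" using r by (auto intro!: continuous_on_interior[OF holomorphic_on_imp_continuous_on])
  then obtain e where e: "0 < e" "\<forall>w. dist z w < e \<longrightarrow> g w \<noteq> 0"
    using continuous_at_avoid[of z g 0] r(3) by auto
  \<comment> \<open>The radius \<open>s\<close> excludes other points of the divisor and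
    \<open>e\<close> excludes zeros of \<open>g\<close>.\<close>
  let ?r = "min r (min s e)"
  have "(\<lambda>w. inverse (g w)) holomorphic_on ball z ?r"
    by (intro holomorphic_intros holomorphic_on_subset[OF r(2)]) (use e in auto)
  moreover have "(if D w < 0 then 0 else inverse (f w)) = (w - z) powi (- D z) * inverse (g w)"
    if "w \<in> ball z ?r" "w \<noteq> z \<or> - D z \<ge> 0" for w
  proof (cases "w = z")
    case True
    with that f r(1) show ?thesis by (cases "D z = 0") auto
  next
    case False
    then have "D w = 0" using s that by auto
    with False that f show ?thesis by (auto simp: power_int_minus)
  qed
  ultimately show "\<exists>r>0. \<exists>h. h holomorphic_on ball z r \<and> h z \<noteq> 0 \<and> (\<forall>w\<in>ball z r. (w \<noteq> z \<or> - D z \<ge> 0) \<longrightarrow>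
      (if D w < 0 then 0 else inverse (f w)) = (w - z) powi (- D z) * h w)"
    using r s e by (intro exI[of _ ?r] conjI exI[of _ "\<lambda>w. inverse (g w)"]) auto
qed

text \<open>Circles of radius \<eta> / 4 around points of the half disc stay in the full disc, so
  Cauchy's inequality bounds the derivative by 4 M / \<eta>; the half disc is convex.\<close>

lemma bounded_holomorphic_lipschitz:
  assumes "0 < \<eta>" "f holomorphic_on ball c \<eta>" "\<And>z. z \<in> ball c \<eta> \<Longrightarrow> cmod (f z) \<le> M"
    and "x \<in> ball c (\<eta> / 2)" "y \<in> ball c (\<eta> / 2)"
  shows "cmod (f x - f y) \<le> 4 * M / \<eta> * cmod (x - y)"
proof (rule field_differentiable_bound[where S = "ball c (\<eta> / 2)" and f' = "deriv f"])
  fix z assume z: "z \<in> ball c (\<eta> / 2)"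
  then have "z \<in> ball c \<eta>" using assms(1) by auto
  then show "(f has_field_derivative deriv f z) (at z within ball c (\<eta> / 2))"
    by (rule has_field_derivative_at_within[OF holomorphic_derivI[OF assms(2) open_ball]])
  have sub: "cball z (\<eta> / 4) \<subseteq> ball c \<eta>"
  proof
    fix w assume "w \<in> cball z (\<eta> / 4)"
    with z assms(1) show "w \<in> ball c \<eta>" using dist_triangle[of c w z] by simp
  qed
  then have hol: "f holomorphic_on cball z (\<eta> / 4)"
    by (rule holomorphic_on_subset[OF assms(2)])
  have "cmod ((deriv ^^ 1) f z) \<le> fact 1 * M / (\<eta> / 4) ^ 1"
  proof (rule Cauchy_inequality)
    show "f holomorphic_on ball z (\<eta> / 4)" "continuous_on (cball z (\<eta> / 4)) f"
      by (rule holomorphic_on_subset[OF hol ball_subset_cball], rule holomorphic_on_imp_continuous_on[OF hol])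
    fix w assume "cmod (z - w) = \<eta> / 4"
    then have "w \<in> cball z (\<eta> / 4)" by (simp add: dist_norm)
    with sub show "cmod (f w) \<le> M" using assms(3) by blast
  qed (use assms in simp)
  then show "cmod (deriv f z) \<le> 4 * M / \<eta>" by (simp add: mult.commute)
qed (use assms in auto)

section \<open>The chordal metric as a Euclidean distance\<close>

definition stereographic :: "complex option \<Rightarrow> complex \<times> real" where
  "stereographic p = (case p of None \<Rightarrow> (0, 1)
     | Some a \<Rightarrow> (of_real (2 / (1 + (cmod a)\<^sup>2)) * a, 1 - 2 / (1 + (cmod a)\<^sup>2)))"

text \<open>\<open>stereographic\<close> is the inverse stereographic projection onto the unit
  sphere, with infinity at the north pole (0, 1). Recognising \<open>rho_S\<close> as the distance
  of the images gives the triangle inequality and makes the Arzela--Ascoli theorem for vector-valued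
  functions applicable.\<close>

lemma norm_stereographic_diff: "norm (stereographic p - stereographic q) = rho_S p q"
proof -
  have pos: "0 < 1 + (cmod a)\<^sup>2" for a by (simp add: add_pos_nonneg)
  have none: "norm (stereographic (Some a) - stereographic None) = 2 / sqrt (1 + (cmod a)\<^sup>2)" for a
  proof -
    define p where "p = 1 + (cmod a)\<^sup>2"
    have p: "0 < p" using pos by (simp add: p_def)
    have "(norm (stereographic (Some a) - stereographic None))\<^sup>2 = (cmod (of_real (2 / p) * a))\<^sup>2 + (2 / p)\<^sup>2"
      using p by (simp add: stereographic_def norm_Pair p_def[symmetric] power_divide)
    also have "\<dots> = (2 / p)\<^sup>2 * (cmod a)\<^sup>2 + (2 / p)\<^sup>2"
      using p by (simp add: norm_mult norm_divide power_mult_distrib power_divide)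
    also have "\<dots> = (2 / p)\<^sup>2 * p"
      by (simp add: p_def distrib_left)
    also have "\<dots> = (2 / sqrt p)\<^sup>2"
      using p by (simp add: power_divide power2_eq_square)
    finally show ?thesis using p unfolding p_def by (intro power2_eq_imp_eq[of _ "2 / _"]) auto
  qed
  have some: "norm (stereographic (Some a) - stereographic (Some b)) =
    2 * cmod (a - b) / (sqrt (1 + (cmod a)\<^sup>2) * sqrt (1 + (cmod b)\<^sup>2))" for a b
  proof -
    define A B p q where "A = (cmod a)\<^sup>2" and "B = (cmod b)\<^sup>2" and "p = 1 + A" and "q = 1 + B"
    have p: "0 < p" "0 < q" using pos by (auto simp: A_def B_def p_def q_def)
    have "(cmod (of_real (2 / p) * a - of_real (2 / q) * b))\<^sup>2
        = (2 / p)\<^sup>2 * A + (2 / q)\<^sup>2 * B - (2 / p) * (2 / q) * (2 * (Re a * Re b + Im a * Im b))"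
      unfolding A_def B_def cmod_power2 by (simp add: power2_eq_square algebra_simps)
    \<comment> \<open>Polarisation removes the inner product; what remains is a rational identity in
      A, B and |a - b|^2.\<close>
    moreover have "2 * (Re a * Re b + Im a * Im b) = A + B - (cmod (a - b))\<^sup>2"
      unfolding A_def B_def cmod_power2 by (simp add: power2_eq_square algebra_simps)
    moreover have "(norm (stereographic (Some a) - stereographic (Some b)))\<^sup>2 =
        (cmod (of_real (2 / p) * a - of_real (2 / q) * b))\<^sup>2 + (2 / q - 2 / p)\<^sup>2"
      by (simp add: stereographic_def norm_Pair A_def[symmetric] B_def[symmetric] p_def[symmetric] q_def[symmetric])
    ultimately have "(norm (stereographic (Some a) - stereographic (Some b)))\<^sup>2
       = (2 / p)\<^sup>2 * A + (2 / q)\<^sup>2 * B - (2 / p) * (2 / q) * (A + B - (cmod (a - b))\<^sup>2) + (2 / q - 2 / p)\<^sup>2"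
      by (simp only:)
    also have "\<dots> = 4 * (cmod (a - b))\<^sup>2 / (p * q)"
    proof -
      have AB: "A = p - 1" "B = q - 1" by (simp_all add: p_def q_def)
      show ?thesis unfolding AB using p
        by (simp add: divide_simps) (simp add: power2_eq_square algebra_simps)
    qed
    also have "\<dots> = (2 * cmod (a - b) / (sqrt p * sqrt q))\<^sup>2"
      using p by (simp add: power_divide power_mult_distrib)
    finally show ?thesis using p unfolding p_def q_def A_def B_def
      by (intro power2_eq_imp_eq[of _ "2 * _ / _"]) auto
  qed
  show ?thesis
    using some none none[unfolded norm_minus_commute[of _ "stereographic None"]]
    by (cases p; cases q) simp_all
qed

lemma norm_stereographic_le: "norm (stereographic p) \<le> 3"
proof -
  have "2 / sqrt (1 + (cmod a)\<^sup>2) \<le> 2 / 1" for a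
    by (intro divide_left_mono) (auto intro: add_pos_nonneg)
  then have "rho_S p None \<le> 2" by (cases p) auto
  moreover have "norm (stereographic None) = 1" by (simp add: stereographic_def norm_Pair)
  ultimately show ?thesis
    using norm_triangle_ineq[of "stereographic p - stereographic None" "stereographic None"]
    by (simp add: norm_stereographic_diff)
qed

lemma rho_S_le: "rho_S (Some a) (Some b) \<le> 2 * cmod (a - b)"
proof -
  have "1 * 1 \<le> sqrt (1 + (cmod a)\<^sup>2) * sqrt (1 + (cmod b)\<^sup>2)" by (intro mult_mono) auto
  then have "2 * cmod (a - b) / (sqrt (1 + (cmod a)\<^sup>2) * sqrt (1 + (cmod b)\<^sup>2)) \<le> 2 * cmod (a - b) / 1"
    by (intro divide_left_mono) auto
  then show ?thesis by simp
qed

text \<open>Since |a| <= sqrt (1 + |a|^2), the denominators may be replaced by |a| and |b|, which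
  turns the quotient into a difference of reciprocals. Infinity is sent to 0; excluding
  \<open>Some 0\<close> keeps the convention \<open>inverse 0 = 0\<close> from confusing it with
  infinity.\<close>

lemma rho_S_le_inverse:
  assumes "p \<noteq> Some 0" "q \<noteq> Some 0"
  shows "rho_S p q \<le> 2 * cmod (case_option 0 inverse p - case_option 0 inverse q)"
proof -
  have le: "cmod a \<le> sqrt (1 + (cmod a)\<^sup>2)" for a by (rule real_le_rsqrt) simp
  have none: "2 / sqrt (1 + (cmod a)\<^sup>2) \<le> 2 * cmod (inverse a)" if "a \<noteq> 0" for a
  proof -
    have "2 / sqrt (1 + (cmod a)\<^sup>2) \<le> 2 / cmod a"
      using le[of a] that by (intro divide_left_mono mult_pos_pos) (auto intro: add_pos_nonneg)
    then show ?thesis by (simp add: norm_inverse divide_inverse)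
  qed
  have some: "2 * cmod (a - b) / (sqrt (1 + (cmod a)\<^sup>2) * sqrt (1 + (cmod b)\<^sup>2)) \<le> 2 * cmod (inverse a - inverse b)"
    if "a \<noteq> 0" "b \<noteq> 0" for a b
  proof -
    have "2 * cmod (a - b) / (sqrt (1 + (cmod a)\<^sup>2) * sqrt (1 + (cmod b)\<^sup>2)) \<le> 2 * cmod (a - b) / (cmod a * cmod b)"
      using le that by (intro divide_left_mono mult_mono mult_pos_pos) (auto intro: add_pos_nonneg)
    also have "inverse a - inverse b = (b - a) / (a * b)" using that by (simp add: field_simps)
    then have "2 * cmod (a - b) / (cmod a * cmod b) = 2 * cmod (inverse a - inverse b)"
      by (simp add: norm_divide norm_mult norm_minus_commute)
    finally show ?thesis .
  qed
  show ?thesis using assms some none by (cases p; cases q) simp_all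
qed

text \<open>All translates of F share one modulus of continuity, so their stereographic images are
  bounded and equicontinuous. Arzela--Ascoli applies on each disc of radius i, and a diagonal
  subsequence works on all of them.\<close>

lemma normal_function_of_uniform_modulus:
  assumes L: "0 < d" "0 \<le> L" "\<And>x y. cmod (x - y) < d \<Longrightarrow> rho_S (F x) (F y) \<le> L * cmod (x - y)"
  shows "normal_function F"
  unfolding normal_function_def
proof
  fix h :: "nat \<Rightarrow> complex"
  define P where "P i s = (\<forall>e>0. \<exists>N. \<forall>m\<ge>N. \<forall>n\<ge>N. \<forall>z\<in>cball 0 (real i).
     rho_S (F (z + h (s n))) (F (z + h (s m))) < e)" for i :: nat and s :: "nat \<Rightarrow> nat"
  obtain k where k: "strict_mono (k :: nat \<Rightarrow> nat)" "\<And>i. P i (id \<circ> k)"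
  proof (rule subsequence_diagonalization_lemma[of P id])
    fix i :: nat and s :: "nat \<Rightarrow> nat"
    let ?F = "\<lambda>n z. stereographic (F (z + h (s n)))"
    obtain g k where k: "continuous_on (cball 0 (real i)) g" "strict_mono (k :: nat \<Rightarrow> nat)"
      "\<And>e. 0 < e \<Longrightarrow> \<exists>N. \<forall>n x. n \<ge> N \<and> x \<in> cball 0 (real i) \<longrightarrow> norm (?F (k n) x - g x) < e"
    proof (rule Arzela_Ascoli[of "cball 0 (real i)" ?F 3])
      fix x :: complex and e :: real assume "0 < e"
      show "\<exists>d. 0 < d \<and> (\<forall>n y. y \<in> cball 0 (real i) \<and> norm (x - y) < d \<longrightarrow> norm (?F n x - ?F n y) < e)"
      proof (intro exI conjI allI impI)
        \<comment> \<open>Dividing by L + 1 rather than L covers the case L = 0.\<close>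
        show "0 < min d (e / (L + 1))" using L \<open>0 < e\<close> by simp
        fix n y assume "y \<in> cball 0 (real i) \<and> cmod (x - y) < min d (e / (L + 1))"
        then have y: "cmod (x - y) < d" "(L + 1) * cmod (x - y) < e"
          using L(2) by (simp_all add: less_divide_eq mult.commute)
        have "norm (?F n x - ?F n y) \<le> L * cmod (x - y)"
          using L(3)[of "x + h (s n)" "y + h (s n)"] y by (simp add: norm_stereographic_diff)
        also have "\<dots> \<le> (L + 1) * cmod (x - y)" by (simp add: mult_right_mono)
        finally show "norm (?F n x - ?F n y) < e" using y by linarith
      qed
    qed (auto simp: norm_stereographic_le)
    have "P i (s \<circ> k)"
      unfolding P_def
    proof (intro allI impI)
      fix e :: real assume "0 < e"
      then obtain N where N: "\<And>n x. n \<ge> N \<Longrightarrow> x \<in> cball 0 (real i) \<Longrightarrow> norm (?F (k n) x - g x) < e / 2"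
        using k(3)[of "e / 2"] by auto
      have "rho_S (F (z + h ((s \<circ> k) n))) (F (z + h ((s \<circ> k) m))) < e" if "m \<ge> N" "n \<ge> N" "z \<in> cball 0 (real i)" for m n z
        using N[OF that(1,3)] N[OF that(2,3)] norm_triangle_ineq4[of "?F (k n) z - g z" "?F (k m) z - g z"]
        by (simp flip: norm_stereographic_diff)
      then show "\<exists>N. \<forall>m\<ge>N. \<forall>n\<ge>N. \<forall>z\<in>cball 0 (real i). rho_S (F (z + h ((s \<circ> k) n))) (F (z + h ((s \<circ> k) m))) < e"
        by blast
    qed
    with k(2) show "\<exists>k. strict_mono (k :: nat \<Rightarrow> nat) \<and> P i (s \<circ> k)" by blast
  next
    \<comment> \<open>The diagonal sequence is only eventually a subsequence of each chosen one; a
      uniform Cauchy condition does not see finitely many terms.\<close>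
    fix i N :: nat and s k1 k2 :: "nat \<Rightarrow> nat"
    assume P: "P i (s \<circ> k1)" and k: "\<And>j. N \<le> j \<Longrightarrow> \<exists>j'. j \<le> j' \<and> k2 j = k1 j'"
    show "P i (s \<circ> k2)"
      unfolding P_def
    proof (intro allI impI)
      fix e :: real assume "0 < e"
      then obtain M where M: "\<forall>m\<ge>M. \<forall>n\<ge>M. \<forall>z\<in>cball 0 (real i). rho_S (F (z + h ((s \<circ> k1) n))) (F (z + h ((s \<circ> k1) m))) < e"
        using P unfolding P_def by blast
      have "rho_S (F (z + h ((s \<circ> k2) n))) (F (z + h ((s \<circ> k2) m))) < e"
        if mn: "m \<ge> max M N" "n \<ge> max M N" "z \<in> cball 0 (real i)" for m n z
      proof -
        obtain m' n' where "m \<le> m'" "k2 m = k1 m'" "n \<le> n'" "k2 n = k1 n'"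
          using k[of m] k[of n] mn by auto
        then show ?thesis using M[rule_format, of m' n' z] mn by simp
      qed
      then show "\<exists>M. \<forall>m\<ge>M. \<forall>n\<ge>M. \<forall>z\<in>cball 0 (real i). rho_S (F (z + h ((s \<circ> k2) n))) (F (z + h ((s \<circ> k2) m))) < e"
        by blast
    qed
  qed blast
  show "\<exists>\<sigma>::nat \<Rightarrow> nat. strict_mono \<sigma> \<and> (\<forall>K. compact K \<longrightarrow> (\<forall>e>0. \<exists>N::nat. \<forall>m\<ge>N. \<forall>n\<ge>N. \<forall>z\<in>K.
            rho_S (F (z + h (\<sigma> n))) (F (z + h (\<sigma> m))) < e))"
  proof (rule exI[of _ k], intro conjI allI impI)
    fix K :: "complex set" and e :: real
    assume "compact K" "0 < e"
    then obtain B where B: "\<And>z. z \<in> K \<Longrightarrow> cmod z \<le> B"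
      using compact_imp_bounded bounded_iff by metis
    have "K \<subseteq> cball 0 (real (nat \<lceil>B\<rceil>))"
      by (auto intro!: order_trans[OF B real_nat_ceiling_ge])
    moreover have "\<exists>N. \<forall>m\<ge>N. \<forall>n\<ge>N. \<forall>z\<in>cball 0 (real (nat \<lceil>B\<rceil>)). rho_S (F (z + h (k n))) (F (z + h (k m))) < e"
      using k(2)[of "nat \<lceil>B\<rceil>"] \<open>0 < e\<close> unfolding P_def by simp
    ultimately show "\<exists>N. \<forall>m\<ge>N. \<forall>n\<ge>N. \<forall>z\<in>K. rho_S (F (z + h (k n))) (F (z + h (k m))) < e"
      by (meson subsetD)
  qed (rule k(1))
qed

text \<open>In the first case the function, in the second its reciprocal, is holomorphic and bounded on
  the whole disc, so that Cauchy's estimate bounds the spherical derivative uniformly.\<close>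

lemma normal_function_of_local_bounds:
  assumes mero: "meromorphic_with_divisor f D" and div: "is_divisor D" and "0 < \<eta>" "0 < M"
    and bounds: "\<And>c. (\<forall>z\<in>ball c \<eta>. 0 \<le> D z \<and> cmod (f z) \<le> M) \<or>
                      (\<forall>z\<in>ball c \<eta>. D z \<le> 0 \<and> (D z = 0 \<longrightarrow> 1 / M \<le> cmod (f z)))"
  shows "normal_function (\<lambda>z. if D z < 0 then None else Some (f z))"
proof (rule normal_function_of_uniform_modulus)
  let ?F = "\<lambda>z. if D z < 0 then None else Some (f z)"
  show "0 < \<eta> / 2" "0 \<le> 2 * (4 * M / \<eta>)" using assms by auto
  fix x y assume "cmod (x - y) < \<eta> / 2"
  then have xy: "x \<in> ball x (\<eta> / 2)" "y \<in> ball x (\<eta> / 2)" using \<open>0 < \<eta>\<close> by (auto simp: dist_norm)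
  then have xy': "x \<in> ball x \<eta>" "y \<in> ball x \<eta>" using \<open>0 < \<eta>\<close> by auto
  consider (hol) "\<forall>z\<in>ball x \<eta>. 0 \<le> D z \<and> cmod (f z) \<le> M"
    | (recip) "\<forall>z\<in>ball x \<eta>. D z \<le> 0 \<and> (D z = 0 \<longrightarrow> 1 / M \<le> cmod (f z))"
    using bounds[of x] by blast
  then show "rho_S (?F x) (?F y) \<le> 2 * (4 * M / \<eta>) * cmod (x - y)"
  proof cases
    case hol
    have "cmod (f x - f y) \<le> 4 * M / \<eta> * cmod (x - y)"
      using hol xy by (intro bounded_holomorphic_lipschitz[OF \<open>0 < \<eta>\<close>] holomorphic_if_divisor_nonneg[OF mero]) auto
    moreover have "?F x = Some (f x)" "?F y = Some (f y)" using hol xy' by (auto simp: not_less)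
    ultimately show ?thesis using rho_S_le[of "f x" "f y"] by simp
  next
    case recip
    let ?g = "\<lambda>z. if D z < 0 then 0 else inverse (f z)"
    \<comment> \<open>At a pole the reciprocal is 0 by definition; elsewhere the lower bound on |f|
      both bounds the reciprocal and rules out the value \<open>Some 0\<close>.\<close>
    have g: "cmod (?g z) \<le> M" "?F z \<noteq> Some 0" "?g z = case_option 0 inverse (?F z)" if "z \<in> ball x \<eta>" for z
    proof -
      have *: "1 / M \<le> cmod (f z)" if "\<not> D z < 0" using recip \<open>z \<in> ball x \<eta>\<close> that by force
      have M: "0 < 1 / M" using \<open>0 < M\<close> by simp
      have "inverse (cmod (f z)) \<le> M" if "\<not> D z < 0"
        using le_imp_inverse_le[OF *[OF that] M] by simp
      then show "cmod (?g z) \<le> M" using \<open>0 < M\<close> by (simp add: norm_inverse)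
      show "?F z \<noteq> Some 0" by (cases "D z < 0") (use * M in auto)
    qed simp
    have "cmod (?g x - ?g y) \<le> 4 * M / \<eta> * cmod (x - y)"
      using recip g(1) xy
      by (intro bounded_holomorphic_lipschitz[OF \<open>0 < \<eta>\<close>]
          holomorphic_if_divisor_nonneg[OF reciprocal_meromorphic_with_divisor[OF mero div]]) auto
    then show ?thesis
      using rho_S_le_inverse[OF g(2)[OF xy'(1)] g(2)[OF xy'(2)]] g(3)[OF xy'(1)] g(3)[OF xy'(2)] by simp
  qed
qed

section \<open>Uniform estimates\<close>

text \<open>Hypotheses (b), (d), (e) with the integrals over t already evaluated point by point,
  which is where \<open>log_cutoff\<close> enters. The constants are fixed parameters, so that every
  later bound is explicit in them and visibly independent of c.\<close>

locale balanced_divisor =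
  fixes D :: "complex \<Rightarrow> int" and Cb Cd Ce :: real
  assumes locally_finite: "\<And>R. finite {w. D w \<noteq> 0 \<and> cmod w \<le> R}"
    and D_0: "D 0 = 0"
    and density: "\<And>c. (\<Sum>w | D w \<noteq> 0 \<and> cmod (w - c) \<le> 1. real_of_int \<bar>D w\<bar>) \<le> Cb"
    and balance: "\<And>c r. 1 < r \<Longrightarrow>
      \<bar>\<Sum>w | D w \<noteq> 0 \<and> cmod (w - c) < r. of_int (D w) * log_cutoff r (cmod (w - c))\<bar> \<le> Cd"
    and moment: "\<And>c r. 1 < r \<Longrightarrow>
      cmod (\<Sum>w | D w \<noteq> 0 \<and> cmod (w - c) < r. of_int (D w) * (w - c) * of_real (log_cutoff r (cmod (w - c)))) \<le> Ce * r"
begin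

section \<open>Mass and net charge of discs and annuli\<close>

definition disc :: "complex \<Rightarrow> real \<Rightarrow> complex set" where
  "disc c r = {w. D w \<noteq> 0 \<and> cmod (w - c) < r}"

lemma finite_support_bounded: "bounded B \<Longrightarrow> finite {w \<in> B. D w \<noteq> 0}"
proof -
  assume "bounded B"
  then obtain R where "\<And>w. w \<in> B \<Longrightarrow> cmod w \<le> R"
    by (auto simp: bounded_iff)
  then show ?thesis
    by (intro finite_subset[OF _ locally_finite[of R]]) auto
qed

lemma finite_cdisc: "finite {w. D w \<noteq> 0 \<and> cmod (w - c) \<le> r}"
  by (rule finite_subset[OF _ finite_support_bounded[of "cball c r"]])
    (auto simp: dist_norm norm_minus_commute)

lemma finite_disc: "finite (disc c r)"
  by (rule finite_subset[OF _ finite_cdisc[of c r]]) (auto simp: disc_def)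

lemma disc_mono: "r \<le> s \<Longrightarrow> disc c r \<subseteq> disc c s"
  by (auto simp: disc_def)

lemma constants_nonneg: "0 \<le> Cb" "0 \<le> Cd" "0 \<le> Ce"
proof -
  show "0 \<le> Cb" using density[of 0] by (rule order_trans[rotated]) (simp add: sum_nonneg)
  show "0 \<le> Cd" using balance[of 2 0] by linarith
  show "0 \<le> Ce"
    using moment[of 2 0] norm_ge_zero[of "\<Sum>w | D w \<noteq> 0 \<and> cmod (w - 0) < 2. of_int (D w) * (w - 0) * of_real (log_cutoff 2 (cmod (w - 0)))"]
    by linarith
qed

text \<open>The kernel vanishes from distance r on, so the index set may be enlarged. Superpositions
  depend on this: the sum runs over one fixed set while the scale varies.\<close>

lemma sum_log_cutoff:
  fixes g :: "complex \<Rightarrow> 'a::real_normed_algebra_1"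
  assumes "finite A" "disc c r \<subseteq> A"
  shows "(\<Sum>w\<in>A. of_int (D w) * g w * of_real (log_cutoff r (cmod (w - c)))) =
    (\<Sum>w\<in>disc c r. of_int (D w) * g w * of_real (log_cutoff r (cmod (w - c))))"
proof (intro sum.mono_neutral_right ballI)
  fix w assume "w \<in> A - disc c r"
  then have "D w = 0 \<or> r \<le> cmod (w - c)" by (auto simp: disc_def)
  then show "of_int (D w) * g w * of_real (log_cutoff r (cmod (w - c))) = 0"
    by (auto simp: log_cutoff_eq_0)
qed (use assms in auto)

lemma balance_le:
  assumes "finite A" "disc c r \<subseteq> A" "1 \<le> r"
  shows "\<bar>\<Sum>w\<in>A. of_int (D w) * log_cutoff r (cmod (w - c))\<bar> \<le> Cd"
proof (cases "r = 1")
  case True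
  then show ?thesis by (simp add: log_cutoff_eq_0 constants_nonneg)
next
  case False
  then show ?thesis
    using sum_log_cutoff[OF assms(1,2), of "\<lambda>_. 1::real"] balance[of r c] assms(3) by (simp add: disc_def)
qed

lemma moment_le:
  assumes "finite A" "disc c r \<subseteq> A" "1 \<le> r"
  shows "cmod (\<Sum>w\<in>A. of_int (D w) * (w - c) * of_real (log_cutoff r (cmod (w - c)))) \<le> Ce * r"
proof (cases "r = 1")
  case True
  then show ?thesis by (simp add: log_cutoff_eq_0 constants_nonneg)
next
  case False
  then show ?thesis
    using sum_log_cutoff[OF assms(1,2), of "\<lambda>w. w - c"] moment[of r c] assms(3) by (simp add: disc_def)
qed

text \<open>Double counting: integrate over z in U the mass within distance 1 of z. By (b) the
  integrand is at most Cb, while each w contributes |D w| times the area \<pi> of its unit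
  disc.\<close>

lemma mass_le_area:
  assumes "finite A" "U \<in> lmeasurable" "\<And>w. w \<in> A \<Longrightarrow> cball w 1 \<subseteq> U"
  shows "pi * (\<Sum>w\<in>A. real_of_int \<bar>D w\<bar>) \<le> Cb * measure lebesgue U"
proof -
  let ?h = "\<lambda>z. \<Sum>w\<in>A. real_of_int \<bar>D w\<bar> * indicat_real (cball w 1) z"
  have int: "integrable lebesgue (\<lambda>z. real_of_int \<bar>D w\<bar> * indicat_real (cball w 1) z)" for w
    by (intro integrable_mult_right integrable_real_indicator) (use lmeasurable_cball[of w 1] in \<open>auto simp: fmeasurable_def\<close>)
  have "integral\<^sup>L lebesgue ?h = (\<Sum>w\<in>A. real_of_int \<bar>D w\<bar> * measure lebesgue (cball w 1))"
    by (subst Bochner_Integration.integral_sum) (use int in auto)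
  also have "\<dots> = pi * (\<Sum>w\<in>A. real_of_int \<bar>D w\<bar>)"
    by (simp add: content_cball unit_ball_vol_2 sum_distrib_left mult.commute)
  finally have eq: "integral\<^sup>L lebesgue ?h = pi * (\<Sum>w\<in>A. real_of_int \<bar>D w\<bar>)" .
  have "integral\<^sup>L lebesgue ?h \<le> integral\<^sup>L lebesgue (\<lambda>z. Cb * indicat_real U z)"
  proof (rule integral_mono)
    show "integrable lebesgue ?h" using int by auto
    show "integrable lebesgue (\<lambda>z. Cb * indicat_real U z)"
      using assms(2) by (intro integrable_mult_right integrable_real_indicator) (auto simp: fmeasurable_def)
    fix z
    show "?h z \<le> Cb * indicat_real U z"
    proof (cases "z \<in> U")
      case True
      have "?h z = (\<Sum>w\<in>{w\<in>A. cmod (w - z) \<le> 1}. real_of_int \<bar>D w\<bar>)"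
        using assms(1) by (intro sum.mono_neutral_cong_right) (auto simp: indicator_def dist_norm)
      also have "\<dots> = (\<Sum>w\<in>{w\<in>A. D w \<noteq> 0 \<and> cmod (w - z) \<le> 1}. real_of_int \<bar>D w\<bar>)"
        using assms(1) by (intro sum.mono_neutral_right) auto
      also have "\<dots> \<le> (\<Sum>w | D w \<noteq> 0 \<and> cmod (w - z) \<le> 1. real_of_int \<bar>D w\<bar>)"
        by (intro sum_mono2 finite_cdisc) auto
      also have "\<dots> \<le> Cb" by (rule density)
      finally show ?thesis using True by simp
    next
      case False
      then have "\<And>w. w \<in> A \<Longrightarrow> z \<notin> cball w 1" using assms(3) by blast
      then have "?h z = 0" by (intro sum.neutral) (simp add: indicator_def)
      with False show ?thesis by simp
    qed
  qed
  also have "\<dots> = Cb * measure lebesgue U" by simp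
  finally show ?thesis by (simp only: eq)
qed

text \<open>The unit discs around points of the annulus lie in the annulus widened by 1 on both
  sides. For bounded width the mass therefore grows only linearly in the radius.\<close>

lemma annulus_mass:
  assumes "1 \<le> s" "s \<le> t" "finite A" "\<And>w. w \<in> A \<Longrightarrow> s \<le> cmod (w - c) \<and> cmod (w - c) \<le> t"
  shows "(\<Sum>w\<in>A. real_of_int \<bar>D w\<bar>) \<le> Cb * ((t + 1)\<^sup>2 - (s - 1)\<^sup>2)"
proof -
  let ?U = "cball c (t + 1) - ball c (s - 1)"
  have "pi * (\<Sum>w\<in>A. real_of_int \<bar>D w\<bar>) \<le> Cb * measure lebesgue ?U"
  proof (rule mass_le_area)
    show "?U \<in> lmeasurable" by (intro fmeasurable.Diff) auto
    fix w assume "w \<in> A"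
    show "cball w 1 \<subseteq> ?U"
    proof
      fix z assume "z \<in> cball w 1"
      then have "cmod (w - z) \<le> 1" by (simp add: dist_norm)
      then show "z \<in> ?U"
        using assms(4)[OF \<open>w \<in> A\<close>] norm_triangle_ineq4[of "w - c" "w - z"] norm_triangle_ineq[of "w - z" "z - c"]
        by (simp add: dist_norm norm_minus_commute)
    qed
  qed (rule assms)
  also have "measure lebesgue ?U = pi * ((t + 1)\<^sup>2 - (s - 1)\<^sup>2)"
  proof -
    have "measure lebesgue ?U = measure lebesgue (cball c (t + 1)) - measure lebesgue (ball c (s - 1))"
      using assms by (intro measurable_measure_Diff) auto
    then show ?thesis
      using assms by (simp add: content_cball content_ball unit_ball_vol_2 right_diff_distrib)
  qed
  finally show ?thesis by (simp add: mult.left_commute)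
qed

text \<open>Compare (d) at the radii r + 1 and r. On the inner disc the two kernels differ by the
  constant \<mu>, which isolates the net charge; the remaining points lie in an annulus of width 1,
  whose mass is O(r). Since \<mu> is of order 1 / r, the charge is O(r), better than the O(r^2) for
  the mass.\<close>

lemma charge_le:
  assumes "1 \<le> r"
  shows "\<bar>\<Sum>w\<in>disc c r. real_of_int (D w)\<bar> \<le> (4 * Cd + 9 * Cb) * r"
proof -
  define \<mu> where "\<mu> = ln ((r + 1) / r)"
  have r: "0 < r" using assms by simp
  have "1 / (r + 1) = 1 - 1 / ((r + 1) / r)" using r by (simp add: field_simps)
  also have "\<dots> \<le> \<mu>" unfolding \<mu>_def using r ln_le_minus_one[of "r / (r + 1)"] 
    by (simp add: ln_div)
  finally have \<mu>: "1 / (r + 1) \<le> \<mu>" .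
  then have \<mu>0: "0 < \<mu>" using r by (smt (verit) divide_pos_pos)
  let ?A = "disc c (r + 1)" and ?B = "disc c (r + 1) - disc c r"
  let ?l = "\<lambda>s w. log_cutoff s (cmod (w - c))"
  have split: "(\<Sum>w\<in>?A. f w) = (\<Sum>w\<in>disc c r. f w) + (\<Sum>w\<in>?B. f w)" for f :: "complex \<Rightarrow> real"
    using sum.subset_diff[of "disc c r" ?A f] by (simp add: finite_disc disc_mono)
  have in_disc: "?l (r + 1) w - ?l r w = \<mu>" if "w \<in> disc c r" for w
    using that assms by (simp add: disc_def log_cutoff_less \<mu>_def ln_div)
  have in_B: "?l r w = 0" "0 \<le> ?l (r + 1) w" "?l (r + 1) w \<le> \<mu>" if "w \<in> ?B" for w
  proof -
    have w: "r \<le> cmod (w - c)" "cmod (w - c) < r + 1" using that by (auto simp: disc_def)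
    then show "?l r w = 0" "0 \<le> ?l (r + 1) w" by (simp_all add: log_cutoff_eq_0 log_cutoff_nonneg)
    have "max 1 (cmod (w - c)) = cmod (w - c)" using w assms by simp
    moreover have "ln ((r + 1) / cmod (w - c)) \<le> ln ((r + 1) / r)"
      using w r by (intro ln_mono divide_left_mono mult_pos_pos divide_pos_pos) auto
    ultimately show "?l (r + 1) w \<le> \<mu>"
      using w r by (simp add: log_cutoff_less \<mu>_def)
  qed
  have "(\<Sum>w\<in>?A. of_int (D w) * ?l (r + 1) w) - (\<Sum>w\<in>?A. of_int (D w) * ?l r w)
      = (\<Sum>w\<in>?A. of_int (D w) * (?l (r + 1) w - ?l r w))"
    by (simp add: sum_subtractf right_diff_distrib)
  also have "\<dots> = \<mu> * (\<Sum>w\<in>disc c r. of_int (D w)) + (\<Sum>w\<in>?B. of_int (D w) * ?l (r + 1) w)"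
    unfolding split sum_distrib_left using in_disc in_B(1)
    by (intro arg_cong2[where f = "(+)"] sum.cong) auto
  finally have "\<mu> * (\<Sum>w\<in>disc c r. of_int (D w)) =
    (\<Sum>w\<in>?A. of_int (D w) * ?l (r + 1) w) - (\<Sum>w\<in>?A. of_int (D w) * ?l r w) - (\<Sum>w\<in>?B. of_int (D w) * ?l (r + 1) w)"
    by simp
  moreover have "\<bar>\<Sum>w\<in>?A. of_int (D w) * ?l (r + 1) w\<bar> \<le> Cd" "\<bar>\<Sum>w\<in>?A. of_int (D w) * ?l r w\<bar> \<le> Cd"
    using assms by (auto intro!: balance_le finite_disc disc_mono)
  moreover have "\<bar>\<Sum>w\<in>?B. of_int (D w) * ?l (r + 1) w\<bar> \<le> \<mu> * (Cb * ((r + 1 + 1)\<^sup>2 - (r - 1)\<^sup>2))"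
  proof -
    have "\<bar>\<Sum>w\<in>?B. of_int (D w) * ?l (r + 1) w\<bar> \<le> (\<Sum>w\<in>?B. real_of_int \<bar>D w\<bar> * \<mu>)"
      by (rule order_trans[OF sum_abs]) (auto simp: abs_mult log_cutoff_nonneg intro!: sum_mono mult_mono in_B simp del: Diff_iff)
    also have "\<dots> = \<mu> * (\<Sum>w\<in>?B. real_of_int \<bar>D w\<bar>)"
      by (simp add: sum_distrib_left mult.commute)
    also have "\<dots> \<le> \<mu> * (Cb * ((r + 1 + 1)\<^sup>2 - (r - 1)\<^sup>2))"
      using assms \<mu>0 by (intro mult_left_mono annulus_mass[of _ _ _ c] finite_Diff finite_disc) (auto simp: disc_def)
    finally show ?thesis .
  qed
  ultimately have "\<mu> * \<bar>\<Sum>w\<in>disc c r. real_of_int (D w)\<bar> \<le> 2 * Cd + \<mu> * (Cb * ((r + 1 + 1)\<^sup>2 - (r - 1)\<^sup>2))"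
    using \<mu>0 abs_mult[of \<mu> "\<Sum>w\<in>disc c r. real_of_int (D w)"] by linarith
  also have "2 * Cd \<le> \<mu> * (2 * Cd * (r + 1))"
    using mult_right_mono[OF \<mu>, of "2 * Cd * (r + 1)"] constants_nonneg r by simp
  finally have "\<bar>\<Sum>w\<in>disc c r. real_of_int (D w)\<bar> \<le> 2 * Cd * (r + 1) + Cb * ((r + 1 + 1)\<^sup>2 - (r - 1)\<^sup>2)"
    using \<mu>0 by (simp add: distrib_left[symmetric])
  \<comment> \<open>For r >= 1 one has r + 1 <= 2 r and (r + 2)^2 - (r - 1)^2 = 6 r + 3 <= 9
    r.\<close>
  also have "\<dots> \<le> 2 * Cd * (2 * r) + Cb * (9 * r)"
    using assms constants_nonneg by (intro add_mono mult_left_mono) (auto simp: power2_eq_square algebra_simps)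
  finally show ?thesis by (simp add: algebra_simps)
qed

text \<open>Superpose (e) with the weight 4 / s^3: the integral contributes 4 Ce / R - 4 Ce / r, the
  two logarithmic boundary terms 2 Ce / r and 2 Ce / R. The bound does not depend on the centre, and
  the outer radius r drops out.\<close>

lemma moment_kernel_le:
  assumes "1 \<le> R" "R \<le> r"
  shows "cmod (\<Sum>w\<in>disc c r. of_int (D w) * cnj (w - c) *
    of_real (1 / (max (cmod (w - c)) R)\<^sup>2 - 1 / r\<^sup>2)) \<le> 6 * Ce / R"
proof -
  let ?l = "\<lambda>s w. log_cutoff s (cmod (w - c))"
  let ?g = "\<lambda>w. of_int (D w) * (w - c)"
  let ?K = "\<lambda>w. 1 / (max (cmod (w - c)) R)\<^sup>2 - 1 / r\<^sup>2"
  let ?S = "\<Sum>w\<in>disc c r. ?g w * of_real (?K w)"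
  let ?E = "\<lambda>s. \<Sum>w\<in>disc c r. ?g w * of_real (?l s w)"
  have E: "cmod (?E s) \<le> Ce * s" if "1 \<le> s" "s \<le> r" for s
    using that by (intro moment_le finite_disc disc_mono)
  have "cmod (\<Sum>w\<in>disc c r. ?g w * of_real (1 / (max (cmod (w - c)) R)\<^sup>2 - 1 / r\<^sup>2
      - 2 / r\<^sup>2 * ?l r w + 2 / R\<^sup>2 * ?l R w)) \<le> - 4 * Ce / r - (- 4 * Ce / R)"
  proof (rule norm_sum_superposition_le[OF finite_disc log_cutoff_has_integral_cubic[OF assms]])
    show "((\<lambda>s. 4 * Ce / s\<^sup>2) has_integral - 4 * Ce / r - - 4 * Ce / R) {R..r}"
      using assms by (intro fundamental_theorem_of_calculus)
       (auto intro!: derivative_eq_intros simp: power2_eq_square simp flip: has_real_derivative_iff_has_vector_derivative)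
    fix s assume s: "s \<in> {R..r}"
    have "(\<Sum>w\<in>disc c r. ?g w * of_real (4 / s ^ 3 * ?l s w)) = of_real (4 / s ^ 3) * ?E s"
      by (simp add: sum_distrib_left mult_ac)
    then have "cmod (\<Sum>w\<in>disc c r. ?g w * of_real (4 / s ^ 3 * ?l s w)) = 4 / s ^ 3 * cmod (?E s)"
      using s assms by (simp only: norm_mult norm_of_real) simp
    also have "\<dots> \<le> 4 / s ^ 3 * (Ce * s)"
      using s assms by (intro mult_left_mono E) auto
    also have "\<dots> = 4 * Ce / s\<^sup>2"
      by (simp add: power2_eq_square power3_eq_cube)
    finally show "cmod (\<Sum>w\<in>disc c r. ?g w * of_real (4 / s ^ 3 * ?l s w)) \<le> 4 * Ce / s\<^sup>2" .
  qed (auto simp: disc_def)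
  also have "(\<Sum>w\<in>disc c r. ?g w * of_real (1 / (max (cmod (w - c)) R)\<^sup>2 - 1 / r\<^sup>2
      - 2 / r\<^sup>2 * ?l r w + 2 / R\<^sup>2 * ?l R w)) = ?S - of_real (2 / r\<^sup>2) * ?E r + of_real (2 / R\<^sup>2) * ?E R"
    unfolding sum_distrib_left sum_subtractf[symmetric] sum.distrib[symmetric]
    by (intro sum.cong refl) (simp only: of_real_add of_real_diff of_real_mult algebra_simps)
  finally have 1: "cmod (?S - of_real (2 / r\<^sup>2) * ?E r + of_real (2 / R\<^sup>2) * ?E R) \<le> 4 * Ce / R - 4 * Ce / r"
    by simp
  have 2: "cmod (of_real (2 / s\<^sup>2) * ?E s) \<le> 2 * Ce / s" if "1 \<le> s" "s \<le> r" for s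
  proof -
    have "cmod (of_real (2 / s\<^sup>2) * ?E s) = 2 / s\<^sup>2 * cmod (?E s)"
      by (simp only: norm_mult norm_of_real) simp
    also have "\<dots> \<le> 2 / s\<^sup>2 * (Ce * s)" using that by (intro mult_left_mono E) auto
    also have "\<dots> = 2 * Ce / s" using that by (simp add: power2_eq_square)
    finally show ?thesis .
  qed
  have triangle: "cmod a \<le> cmod (a - b + d) + cmod b + cmod d" for a b d :: complex
    by norm
  have "cmod ?S \<le> cmod (?S - of_real (2 / r\<^sup>2) * ?E r + of_real (2 / R\<^sup>2) * ?E R)
     + cmod (of_real (2 / r\<^sup>2) * ?E r) + cmod (of_real (2 / R\<^sup>2) * ?E R)"
    by (rule triangle)
  also have "\<dots> \<le> (4 * Ce / R - 4 * Ce / r) + 2 * Ce / r + 2 * Ce / R"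
    using assms by (intro add_mono 1 2) auto
  also have "\<dots> \<le> 6 * Ce / R"
    using constants_nonneg(3) assms by (simp add: field_simps)
  finally have "cmod ?S \<le> 6 * Ce / R" .
  \<comment> \<open>D and the kernel are real, so conjugation changes the sum only to its
    conjugate.\<close>
  moreover have "(\<Sum>w\<in>disc c r. of_int (D w) * cnj (w - c) * of_real (?K w)) = cnj ?S"
    by simp
  ultimately show ?thesis by (simp only: complex_mod_cnj)
qed

text \<open>Superpose (d) with the weight 4 s and divide by R^2: the integral and the boundary term
  cost 2 Cd each, and passing from \<open>max 1\<close> of the distance to the distance itself costs
  Cb.\<close>

lemma quadratic_kernel_le:
  assumes "1 \<le> R"
  shows "\<bar>\<Sum>w\<in>disc c R. of_int (D w) * (1 - (cmod (w - c))\<^sup>2 / R\<^sup>2)\<bar> \<le> 4 * Cd + Cb"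
proof -
  let ?l = "\<lambda>s w. log_cutoff s (cmod (w - c))"
  let ?m = "\<lambda>w. max 1 (cmod (w - c))"
  let ?E = "\<lambda>s. \<Sum>w\<in>disc c R. of_int (D w) * ?l s w"
  have E: "\<bar>?E s\<bar> \<le> Cd" if "1 \<le> s" "s \<le> R" for s
    using that by (intro balance_le finite_disc disc_mono)
  have "cmod (\<Sum>w\<in>disc c R. of_int (D w) * of_real (2 * R\<^sup>2 * ?l R w - (R\<^sup>2 - (?m w)\<^sup>2))) \<le> 2 * Cd * R\<^sup>2 - 2 * Cd * 1\<^sup>2"
  proof (rule norm_sum_superposition_le[OF finite_disc log_cutoff_has_integral_linear[OF assms]])
    show "((\<lambda>s. 4 * s * Cd) has_integral 2 * Cd * R\<^sup>2 - 2 * Cd * 1\<^sup>2) {1..R}"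
      using assms by (intro fundamental_theorem_of_calculus)
       (auto intro!: derivative_eq_intros simp flip: has_real_derivative_iff_has_vector_derivative)
    fix s assume s: "s \<in> {1..R}"
    have "(\<Sum>w\<in>disc c R. of_int (D w) * complex_of_real (4 * s * ?l s w)) = of_real (4 * s * ?E s)"
      by (simp add: sum_distrib_left mult_ac)
    then have "cmod (\<Sum>w\<in>disc c R. of_int (D w) * of_real (4 * s * ?l s w)) = 4 * s * \<bar>?E s\<bar>"
      using s by (simp only: norm_of_real) (simp add: abs_mult)
    also have "\<dots> \<le> 4 * s * Cd" using s by (intro mult_left_mono E) auto
    finally show "cmod (\<Sum>w\<in>disc c R. of_int (D w) * of_real (4 * s * ?l s w)) \<le> 4 * s * Cd" .
  qed (auto simp: disc_def)
  also have "(\<Sum>w\<in>disc c R. of_int (D w) * of_real (2 * R\<^sup>2 * ?l R w - (R\<^sup>2 - (?m w)\<^sup>2)))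
      = complex_of_real (2 * R\<^sup>2 * ?E R - (\<Sum>w\<in>disc c R. of_int (D w) * (R\<^sup>2 - (?m w)\<^sup>2)))"
    unfolding sum_distrib_left sum_subtractf[symmetric] of_real_sum
    by (intro sum.cong refl) (simp add: algebra_simps)
  finally have "\<bar>2 * R\<^sup>2 * ?E R - (\<Sum>w\<in>disc c R. of_int (D w) * (R\<^sup>2 - (?m w)\<^sup>2))\<bar> \<le> 2 * Cd * R\<^sup>2"
    using constants_nonneg by (simp only: norm_of_real) simp
  moreover have "\<bar>2 * R\<^sup>2 * ?E R\<bar> \<le> 2 * Cd * R\<^sup>2"
    using E[of R] assms by (simp add: abs_mult)
  moreover have "\<bar>y\<bar> \<le> 4 * Cd * R\<^sup>2" if "\<bar>x - y\<bar> \<le> 2 * Cd * R\<^sup>2" "\<bar>x\<bar> \<le> 2 * Cd * R\<^sup>2" for x y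
    using that by linarith
  ultimately have 1: "\<bar>\<Sum>w\<in>disc c R. of_int (D w) * (R\<^sup>2 - (?m w)\<^sup>2)\<bar> \<le> 4 * Cd * R\<^sup>2"
    by blast
  \<comment> \<open>The two kernels differ only within distance 1 of c, and there by at most 1, so
    (b) suffices.\<close>
  have "\<bar>\<Sum>w\<in>disc c R. of_int (D w) * ((?m w)\<^sup>2 - (cmod (w - c))\<^sup>2)\<bar> \<le>
     (\<Sum>w\<in>disc c R. real_of_int \<bar>D w\<bar> * (if cmod (w - c) \<le> 1 then 1 else 0))"
    by (rule order_trans[OF sum_abs]) (auto simp: abs_mult abs_le_iff power_le_one max_def intro!: sum_mono mult_left_le)
  also have "\<dots> = (\<Sum>w\<in>{w\<in>disc c R. cmod (w - c) \<le> 1}. real_of_int \<bar>D w\<bar>)"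
    by (intro sum.mono_neutral_cong_right finite_disc) auto
  also have "\<dots> \<le> (\<Sum>w | D w \<noteq> 0 \<and> cmod (w - c) \<le> 1. real_of_int \<bar>D w\<bar>)"
    by (intro sum_mono2 finite_cdisc) (auto simp: disc_def)
  also have "\<dots> \<le> Cb * R\<^sup>2"
    using density[of c] mult_left_mono[of 1 "R\<^sup>2" Cb] constants_nonneg assms by simp
  finally have 2: "\<bar>\<Sum>w\<in>disc c R. of_int (D w) * ((?m w)\<^sup>2 - (cmod (w - c))\<^sup>2)\<bar> \<le> Cb * R\<^sup>2" .
  have "R\<^sup>2 * (\<Sum>w\<in>disc c R. of_int (D w) * (1 - (cmod (w - c))\<^sup>2 / R\<^sup>2)) =
     (\<Sum>w\<in>disc c R. of_int (D w) * (R\<^sup>2 - (?m w)\<^sup>2)) + (\<Sum>w\<in>disc c R. of_int (D w) * ((?m w)\<^sup>2 - (cmod (w - c))\<^sup>2))"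
    unfolding sum.distrib[symmetric] sum_distrib_left using assms
    by (intro sum.cong) (auto simp: field_simps)
  with 1 2 have "\<bar>R\<^sup>2 * (\<Sum>w\<in>disc c R. of_int (D w) * (1 - (cmod (w - c))\<^sup>2 / R\<^sup>2))\<bar> \<le> 4 * Cd * R\<^sup>2 + Cb * R\<^sup>2"
    by linarith
  also have "\<dots> = R\<^sup>2 * (4 * Cd + Cb)" by (simp add: algebra_simps)
  finally show ?thesis using assms by (simp add: abs_mult)
qed

section \<open>The gradient of the averaged potential\<close>

definition charge_const :: real where "charge_const = 4 * Cd + 9 * Cb"

text \<open>The truncation is centred at 0, whereas (e) is exploited around x. Recentring the disc
  at x leaves the moment kernel, of size O(1 / R), together with a charge term and a symmetric
  difference whose contributions vanish as r grows.\<close>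

lemma gradient_le:
  assumes "1 \<le> R" "cmod x \<le> \<rho>" "2 * \<rho> + R + 2 \<le> r"
  shows "cmod (\<Sum>w\<in>disc 0 r. of_int (D w) *
      (cnj w / of_real (r\<^sup>2) - cnj (w - x) / of_real ((max (cmod (w - x)) R)\<^sup>2)))
    \<le> 6 * Ce / R + (\<rho> * charge_const + 16 * Cb * \<rho> * (\<rho> + 1)) / r"
proof -
  let ?A = "disc 0 r" and ?B = "disc x r"
  let ?S = "(?A - ?B) \<union> (?B - ?A)"
  let ?h = "\<lambda>w. cnj w / of_real (r\<^sup>2) - cnj (w - x) / of_real ((max (cmod (w - x)) R)\<^sup>2)"
  let ?k = "\<lambda>w. cnj (w - x) * of_real (1 / (max (cmod (w - x)) R)\<^sup>2 - 1 / r\<^sup>2)"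
  have \<rho>: "0 \<le> \<rho>" using assms(2) norm_ge_zero order_trans by blast
  have r: "0 < r" "1 \<le> r" using assms \<rho> by auto
  have split: "(\<Sum>w\<in>?A. of_int (D w) * ?h w) =
    (\<Sum>w\<in>?B. of_int (D w) * ?h w) + (\<Sum>w\<in>?A - ?B. of_int (D w) * ?h w) - (\<Sum>w\<in>?B - ?A. of_int (D w) * ?h w)"
  proof -
    have "sum f ?A = sum f (?A \<inter> ?B) + sum f (?A - ?B)" "sum f ?B = sum f (?A \<inter> ?B) + sum f (?B - ?A)"
      for f :: "complex \<Rightarrow> complex"
      using sum.Int_Diff[of ?A f ?B] sum.Int_Diff[of ?B f ?A] finite_disc by (simp_all add: Int_commute)
    then show ?thesis by simp
  qed
  \<comment> \<open>Write \<open>cnj w = cnj x + cnj (w - x)\<close>: the first part multiplies the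
    net charge, the second completes the moment kernel.\<close>
  have "(\<Sum>w\<in>?B. of_int (D w) * ?h w) =
      cnj x / of_real (r\<^sup>2) * of_real (\<Sum>w\<in>?B. of_int (D w)) - (\<Sum>w\<in>?B. of_int (D w) * ?k w)"
    unfolding of_real_sum sum_distrib_left sum_subtractf[symmetric]
    by (intro sum.cong refl) (simp add: algebra_simps diff_divide_distrib)
  also have "cmod \<dots> \<le> \<rho> / r\<^sup>2 * (charge_const * r) + 6 * Ce / R"
  proof (rule order_trans[OF norm_triangle_ineq4 add_mono])
    have "cmod (cnj x / of_real (r\<^sup>2) * of_real (\<Sum>w\<in>?B. of_int (D w)))
        = cmod x / r\<^sup>2 * \<bar>\<Sum>w\<in>?B. of_int (D w)\<bar>"
      by (simp only: norm_mult norm_of_real norm_divide complex_mod_cnj) simp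
    also have "\<dots> \<le> \<rho> / r\<^sup>2 * (charge_const * r)"
      unfolding charge_const_def using charge_le[OF r(2), of x] assms \<rho> by (intro mult_mono divide_right_mono) auto
    finally show "cmod (cnj x / of_real (r\<^sup>2) * of_real (\<Sum>w\<in>?B. of_int (D w))) \<le> \<rho> / r\<^sup>2 * (charge_const * r)" .
    show "cmod (\<Sum>w\<in>?B. of_int (D w) * ?k w) \<le> 6 * Ce / R"
      using moment_kernel_le[of R r x] assms \<rho> by (simp add: mult.assoc)
  qed
  finally have B: "cmod (\<Sum>w\<in>?B. of_int (D w) * ?h w) \<le> \<rho> / r\<^sup>2 * (charge_const * r) + 6 * Ce / R" .
  \<comment> \<open>The symmetric difference lies in the annulus between r - \<rho> and r + \<rho>.
    There |w - x| differs from r by at most \<rho>, so the two terms of \<open>?h\<close> nearly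
    cancel; the mass of this annulus is O(r), which leaves an error O(1 / r).\<close>
  have h: "cmod (?h w) \<le> 4 * \<rho> / r\<^sup>2" and loc: "r - \<rho> \<le> cmod w" "cmod w \<le> r + \<rho>" if "w \<in> ?S" for w
  proof -
    let ?d = "cmod (w - x)"
    have t: "cmod w \<le> ?d + cmod x" "?d \<le> cmod w + cmod x"
      using norm_triangle_ineq[of "w - x" x] norm_triangle_ineq4[of w x] by auto
    have "(cmod w < r \<and> r \<le> ?d) \<or> (?d < r \<and> r \<le> cmod w)"
      using that by (auto simp: disc_def)
    then show "r - \<rho> \<le> cmod w" "cmod w \<le> r + \<rho>" using t assms(2) by linarith+
    have d: "\<bar>?d - r\<bar> \<le> \<rho>" "r \<le> 2 * ?d" "R \<le> ?d" "0 < ?d"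
      using \<open>(cmod w < r \<and> r \<le> ?d) \<or> _\<close> t assms \<rho> by linarith+
    have eq: "?h w = cnj x / of_real (r\<^sup>2) + cnj (w - x) * of_real (1 / r\<^sup>2 - 1 / ?d\<^sup>2)"
      using d by (simp add: max_absorb1 algebra_simps diff_divide_distrib)
    have "1 / r\<^sup>2 - 1 / ?d\<^sup>2 = (?d - r) * (?d + r) / (r\<^sup>2 * ?d\<^sup>2)"
      using d r by (simp add: field_simps power2_eq_square)
    then have "?d * \<bar>1 / r\<^sup>2 - 1 / ?d\<^sup>2\<bar> = \<bar>?d - r\<bar> * (?d + r) / (r\<^sup>2 * ?d)"
      using d r by (simp add: abs_mult power2_eq_square)
    also have "\<dots> \<le> \<rho> * (3 * ?d) / (r\<^sup>2 * ?d)"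
      using d r \<rho> by (intro divide_right_mono mult_mono) auto
    also have "\<dots> = 3 * \<rho> / r\<^sup>2" using d by simp
    finally have "cmod (cnj (w - x) * of_real (1 / r\<^sup>2 - 1 / ?d\<^sup>2)) \<le> 3 * \<rho> / r\<^sup>2"
      by (simp only: norm_mult norm_of_real complex_mod_cnj)
    moreover have "cmod (cnj x / of_real (r\<^sup>2)) \<le> \<rho> / r\<^sup>2"
      using assms(2) by (simp add: norm_divide norm_power divide_right_mono)
    ultimately show "cmod (?h w) \<le> 4 * \<rho> / r\<^sup>2"
      unfolding eq by (intro order_trans[OF norm_triangle_ineq]) simp
  qed
  have "cmod ((\<Sum>w\<in>?A - ?B. of_int (D w) * ?h w) - (\<Sum>w\<in>?B - ?A. of_int (D w) * ?h w))
      \<le> (\<Sum>w\<in>?A - ?B. \<bar>D w\<bar> * (4 * \<rho> / r\<^sup>2)) + (\<Sum>w\<in>?B - ?A. \<bar>D w\<bar> * (4 * \<rho> / r\<^sup>2))"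
  proof (rule order_trans[OF norm_triangle_ineq4 add_mono])
    show "cmod (\<Sum>w\<in>?A - ?B. of_int (D w) * ?h w) \<le> (\<Sum>w\<in>?A - ?B. \<bar>D w\<bar> * (4 * \<rho> / r\<^sup>2))"
      by (rule sum_norm_le) (use h in \<open>auto simp only: norm_mult norm_of_int of_int_abs intro!: mult_left_mono\<close>)
    show "cmod (\<Sum>w\<in>?B - ?A. of_int (D w) * ?h w) \<le> (\<Sum>w\<in>?B - ?A. \<bar>D w\<bar> * (4 * \<rho> / r\<^sup>2))"
      by (rule sum_norm_le) (use h in \<open>auto simp only: norm_mult norm_of_int of_int_abs intro!: mult_left_mono\<close>)
  qed
  also have "\<dots> = (\<Sum>w\<in>?S. real_of_int \<bar>D w\<bar>) * (4 * \<rho> / r\<^sup>2)"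
  proof -
    have "(\<Sum>w\<in>?S. real_of_int \<bar>D w\<bar>) = (\<Sum>w\<in>?A - ?B. real_of_int \<bar>D w\<bar>) + (\<Sum>w\<in>?B - ?A. real_of_int \<bar>D w\<bar>)"
      by (intro sum.union_disjoint) (auto simp: finite_disc)
    then show ?thesis by (simp only: distrib_right sum_distrib_right)
  qed
  also have "\<dots> \<le> Cb * ((r + \<rho> + 1)\<^sup>2 - (r - \<rho> - 1)\<^sup>2) * (4 * \<rho> / r\<^sup>2)"
    using assms \<rho> loc by (intro mult_right_mono annulus_mass[of _ _ _ 0]) (auto simp: finite_disc simp del: Un_iff)
  also have "\<dots> = 16 * Cb * \<rho> * (\<rho> + 1) / r"
    using r by (simp add: field_simps power2_eq_square)
  finally have S: "cmod ((\<Sum>w\<in>?A - ?B. of_int (D w) * ?h w) - (\<Sum>w\<in>?B - ?A. of_int (D w) * ?h w))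
      \<le> 16 * Cb * \<rho> * (\<rho> + 1) / r" .
  have "cmod (\<Sum>w\<in>?A. of_int (D w) * ?h w) \<le> \<rho> / r\<^sup>2 * (charge_const * r) + 6 * Ce / R + 16 * Cb * \<rho> * (\<rho> + 1) / r"
    unfolding split add_diff_eq[symmetric] by (rule order_trans[OF norm_triangle_ineq add_mono[OF B S]])
  also have "\<dots> = 6 * Ce / R + (\<rho> * charge_const + 16 * Cb * \<rho> * (\<rho> + 1)) / r"
    using r by (simp add: power2_eq_square add_divide_distrib)
  finally show ?thesis .
qed

section \<open>The exponent \<alpha>\<close>

definition drift :: "real \<Rightarrow> complex" where
  "drift r = (\<Sum>w\<in>disc 0 r. of_int (D w) * (1 / w - cnj w / of_real (r\<^sup>2)))"

text \<open>\<open>drift\<close> is the negative of the expression defining \<alpha>. Because 1 / w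
  = \<open>cnj w\<close> / |w|^2, its increment between two radii is exactly the moment sum at the
  origin.\<close>

lemma drift_diff_le:
  assumes "1 \<le> R" "R \<le> r"
  shows "cmod (drift r - drift R) \<le> 6 * Ce / R"
proof -
  have w: "1 / w = cnj w / of_real ((cmod w)\<^sup>2)" for w
    by (simp add: complex_div_cnj[of 1 w])
  have "drift R = (\<Sum>w\<in>disc 0 r. if cmod w < R then of_int (D w) * (1 / w - cnj w / of_real (R\<^sup>2)) else 0)"
    unfolding drift_def using assms
    by (intro sum.mono_neutral_cong_left finite_disc) (auto simp: disc_def)
  then have "drift r - drift R = (\<Sum>w\<in>disc 0 r. of_int (D w) * (1 / w - cnj w / of_real (r\<^sup>2)) -
      (if cmod w < R then of_int (D w) * (1 / w - cnj w / of_real (R\<^sup>2)) else 0))"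
    by (simp only: drift_def[of r] sum_subtractf)
  also have "\<dots> = (\<Sum>w\<in>disc 0 r. of_int (D w) * cnj (w - 0) *
    of_real (1 / (max (cmod (w - 0)) R)\<^sup>2 - 1 / r\<^sup>2))"
  proof (intro sum.cong refl)
    fix v
    show "of_int (D v) * (1 / v - cnj v / of_real (r\<^sup>2)) -
        (if cmod v < R then of_int (D v) * (1 / v - cnj v / of_real (R\<^sup>2)) else 0) =
      of_int (D v) * cnj (v - 0) * of_real (1 / (max (cmod (v - 0)) R)\<^sup>2 - 1 / r\<^sup>2)"
      by (simp add: w[of v] max_def algebra_simps)
  qed
  finally have "drift r - drift R = (\<Sum>w\<in>disc 0 r. of_int (D w) * cnj (w - 0) *
    of_real (1 / (max (cmod (w - 0)) R)\<^sup>2 - 1 / r\<^sup>2))" .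
  then show ?thesis using moment_kernel_le[OF assms, of 0] by simp
qed

lemma drift_converges: "\<exists>L. (drift \<longlongrightarrow> L) at_top"
proof -
  have "Cauchy (\<lambda>n. drift (real n))"
  proof (rule CauchyI)
    fix e :: real assume "0 < e"
    obtain M :: nat where M: "12 * Ce / e + 1 < real M" using reals_Archimedean2 by blast
    have "0 \<le> 12 * Ce / e" using constants_nonneg \<open>0 < e\<close> by simp
    with M have M0: "0 < real M" "1 \<le> real M" by linarith+
    have "6 * Ce / M < e / 2"
      using M M0 \<open>0 < e\<close> by (simp add: field_simps)
    moreover have "cmod (drift n - drift M) \<le> 6 * Ce / M" if "M \<le> n" for n
      using drift_diff_le M0 that by simp
    ultimately have *: "cmod (drift n - drift M) < e / 2" if "M \<le> n" for n
      using that by force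
    have "cmod (drift m - drift n) < e" if "M \<le> m" "M \<le> n" for m n
      using *[OF that(1)] *[OF that(2)] by (metis dist_norm dist_triangle_half_r dist_commute)
    then show "\<exists>M. \<forall>m\<ge>M. \<forall>n\<ge>M. cmod (drift (real m) - drift (real n)) < e" by blast
  qed
  then obtain L where L: "(\<lambda>n. drift (real n)) \<longlonglongrightarrow> L"
    using Cauchy_convergent_iff convergent_def by blast
  \<comment> \<open>The estimate is uniform in the outer radius, so letting that radius run through
    the integers compares \<open>drift r\<close> at real r with L.\<close>
  have "cmod (drift r - L) \<le> 6 * Ce / r" if "1 \<le> r" for r
  proof (rule tendsto_upperbound)
    show "(\<lambda>n. cmod (drift r - drift (real n))) \<longlonglongrightarrow> cmod (drift r - L)"
      by (intro tendsto_intros L)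
    have "eventually (\<lambda>n. r \<le> real n) sequentially"
      using eventually_ge_at_top[of "nat \<lceil>r\<rceil>"] by eventually_elim linarith
    then show "eventually (\<lambda>n. cmod (drift r - drift (real n)) \<le> 6 * Ce / r) sequentially"
      by eventually_elim (use that in \<open>metis norm_minus_commute drift_diff_le\<close>)
  qed simp
  then have "eventually (\<lambda>r. cmod (drift r - L) \<le> 6 * Ce / r) at_top"
    by (auto intro: eventually_at_top_linorderI)
  moreover have "((\<lambda>r. 6 * Ce / r) \<longlongrightarrow> 0) at_top"
    by (intro tendsto_divide_0[OF tendsto_const] filterlim_at_top_imp_at_infinity filterlim_ident)
  ultimately have "((\<lambda>r. drift r - L) \<longlongrightarrow> 0) at_top"
    by (rule Lim_null_comparison)
  then show ?thesis
    using LIM_zero_cancel by blast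
qed

text \<open>For c off the divisor, the logarithm of the modulus of
  \<open>exp (- drift r * c)\<close> times the partial product: the terms c / w of the drift and of
  the elementary factors cancel, and only the correction with 1 / r^2 stays.\<close>

definition log_potential :: "complex \<Rightarrow> real \<Rightarrow> real" where
  "log_potential c r = (\<Sum>w\<in>disc 0 r. of_int (D w) *
     (ln (cmod (w - c)) - ln (cmod w) + Re (c * cnj w) / r\<^sup>2))"

definition local_log :: "complex \<Rightarrow> real" where
  "local_log c = (\<Sum>w\<in>disc c 1. of_int (D w) * ln (cmod (w - c)))"

text \<open>On the disc of radius R, the smoothing error plus the local logarithm equals
  \<open>log_cutoff\<close> minus half the quadratic kernel. The first sum is at most Cd by (d), the
  second at most 4 Cd + Cb before halving.\<close>

lemma smoothing_le:
  assumes "D c = 0" "1 \<le> R"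
  shows "\<bar>(\<Sum>w\<in>disc c R. of_int (D w) * (smooth_log R ((cmod (w - c))\<^sup>2) - ln (cmod (w - c)))) + local_log c\<bar>
    \<le> 3 * Cd + Cb"
proof -
  let ?v = "\<lambda>w. cmod (w - c)"
  have "local_log c = (\<Sum>w\<in>disc c R. of_int (D w) * (if ?v w < 1 then ln (?v w) else 0))"
    unfolding local_log_def using assms(2)
    by (intro sum.mono_neutral_cong_left finite_disc) (auto simp: disc_def)
  moreover have "smooth_log R ((?v w)\<^sup>2) - ln (?v w) + (if ?v w < 1 then ln (?v w) else 0) =
     log_cutoff R (?v w) - (1 - (?v w)\<^sup>2 / R\<^sup>2) / 2" if "w \<in> disc c R" for w
  proof -
    have v: "0 < ?v w" "?v w < R" using that assms(1) by (auto simp: disc_def)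
    then have "(?v w)\<^sup>2 < R\<^sup>2" by (intro power_strict_mono) auto
    then have "smooth_log R ((?v w)\<^sup>2) = ln R - (1 - (?v w)\<^sup>2 / R\<^sup>2) / 2"
      by (simp add: smooth_log_def field_simps)
    moreover have "log_cutoff R (?v w) = ln R - ln (max 1 (?v w))"
      using v assms(2) by (simp add: log_cutoff_less ln_div)
    ultimately show ?thesis by (auto simp: max_def)
  qed
  then have "(\<Sum>w\<in>disc c R. of_int (D w) * (smooth_log R ((?v w)\<^sup>2) - ln (?v w))) +
      (\<Sum>w\<in>disc c R. of_int (D w) * (if ?v w < 1 then ln (?v w) else 0)) =
      (\<Sum>w\<in>disc c R. of_int (D w) * log_cutoff R (?v w)) -
      (\<Sum>w\<in>disc c R. of_int (D w) * (1 - (?v w)\<^sup>2 / R\<^sup>2)) / 2"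
    unfolding sum.distrib[symmetric] sum_subtractf[symmetric] sum_divide_distrib distrib_left[symmetric]
      right_diff_distrib[symmetric] times_divide_eq_right[symmetric]
    by (intro sum.cong refl arg_cong2[where f = "(*)"])
  moreover have "\<bar>\<Sum>w\<in>disc c R. of_int (D w) * log_cutoff R (?v w)\<bar> \<le> Cd"
    using assms by (intro balance_le finite_disc) auto
  ultimately show ?thesis
    using quadratic_kernel_le[OF assms(2), of c] constants_nonneg by linarith
qed

text \<open>Smoothing the logarithm at scale \<open>R\<close> turns the difference of the potentials at \<open>c\<close> and \<open>0\<close>
  into an integral of a gradient of size \<open>O(1 / R)\<close>; hence \<open>R\<close> comparable to \<open>\<bar>c\<bar>\<close> gives a bound
  that does not depend on \<open>c\<close>.\<close>

lemma log_potential_le: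
  assumes "D c = 0" "3 * cmod c + 3 \<le> r"
  shows "\<bar>log_potential c r - local_log c\<bar> \<le> \<bar>local_log 0\<bar> + 6 * Cd + 2 * Cb + 6 * Ce +
    cmod c * (cmod c * charge_const + 16 * Cb * cmod c * (cmod c + 1)) / r"
proof -
  \<comment> \<open>This R makes |c| / R <= 1, so a gradient O(1 / R) along a segment of length |c|
    changes the potential by O(1) only.\<close>
  define R where "R = cmod c + 1"
  have R: "1 \<le> R" "0 < R" by (simp_all add: R_def add_nonneg_pos)
  have r: "0 < r" using assms(2) by (smt (verit) norm_ge_zero)
  let ?K = "(cmod c * charge_const + 16 * Cb * cmod c * (cmod c + 1)) / r"
  \<comment> \<open>\<open>T x\<close> is the smoothing error at x, \<open>\<Phi> t\<close> the
    smoothed potential at the point t c of the segment, and \<open>G\<close> its gradient in complex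
    notation.\<close>
  define T where "T x = (\<Sum>w\<in>disc x R. of_int (D w) * (smooth_log R ((cmod (w - x))\<^sup>2) - ln (cmod (w - x))))" for x
  define \<Phi> where "\<Phi> t = (\<Sum>w\<in>disc 0 r. of_int (D w) *
     (smooth_log R ((cmod (w - of_real t * c))\<^sup>2) + t * Re (c * cnj w) / r\<^sup>2))" for t :: real
  define G where "G x = (\<Sum>w\<in>disc 0 r. of_int (D w) *
      (cnj w / of_real (r\<^sup>2) - cnj (w - x) / of_real ((max (cmod (w - x)) R)\<^sup>2)))" for x
  \<comment> \<open>Beyond distance R, \<open>smooth_log\<close> agrees with the logarithm, so the
    larger index set adds only zeros.\<close>
  have T: "T x = (\<Sum>w\<in>disc 0 r. of_int (D w) * (smooth_log R ((cmod (w - x))\<^sup>2) - ln (cmod (w - x))))"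
    if "D x = 0" "cmod x \<le> cmod c" for x
    unfolding T_def
  proof (intro sum.mono_neutral_left finite_disc ballI)
    show "disc x R \<subseteq> disc 0 r"
    proof
      fix w assume "w \<in> disc x R"
      then have w: "D w \<noteq> 0" "cmod (w - x) < cmod c + 1" by (auto simp: disc_def R_def)
      moreover have "cmod w \<le> cmod (w - x) + cmod x" using norm_triangle_ineq[of "w - x" x] by simp
      ultimately have "cmod w < r" using assms(2) that(2) norm_ge_zero[of c] by linarith
      with w show "w \<in> disc 0 r" by (simp add: disc_def)
    qed
    fix w assume w: "w \<in> disc 0 r - disc x R"
    then have "R \<le> cmod (w - x)" by (auto simp: disc_def)
    moreover from this have "R\<^sup>2 \<le> (cmod (w - x))\<^sup>2" using R by (intro power_mono) auto
    ultimately show "of_int (D w) * (smooth_log R ((cmod (w - x))\<^sup>2) - ln (cmod (w - x))) = 0"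
      using R by (simp add: smooth_log_def ln_realpow)
  qed
  \<comment> \<open>The terms ln |w| in the potential are its unsmoothed value at 0, so smoothing is
    undone at both ends of the segment.\<close>
  have eq: "log_potential c r = \<Phi> 1 - \<Phi> 0 - T c + T 0"
    unfolding \<Phi>_def log_potential_def T[OF assms(1) order_refl] T[OF D_0 norm_zero[THEN eq_refl, THEN order_trans, OF norm_ge_zero]]
      sum_subtractf[symmetric] sum.distrib[symmetric]
    by (intro sum.cong refl) (simp add: algebra_simps)
  have deriv: "(\<Phi> has_real_derivative Re (c * G (of_real t * c))) (at t)" for t
  proof -
    have 1: "((\<lambda>t. (cmod (w - of_real t * c))\<^sup>2) has_real_derivative - 2 * Re (c * cnj (w - of_real t * c))) (at t)" for w
      unfolding cmod_power2 by (auto intro!: derivative_eq_intros simp: algebra_simps)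
    have 2: "max ((cmod v)\<^sup>2) (R\<^sup>2) = (max (cmod v) R)\<^sup>2" for v :: complex
      using R by (auto simp: max_def)
    have "((\<lambda>t. smooth_log R ((cmod (w - of_real t * c))\<^sup>2)) has_real_derivative
       1 / (2 * max ((cmod (w - of_real t * c))\<^sup>2) (R\<^sup>2)) * (- 2 * Re (c * cnj (w - of_real t * c)))) (at t)" for w
      by (rule DERIV_chain2[OF smooth_log_deriv 1]) (rule R)
    from this[unfolded 2] have 3: "((\<lambda>t. smooth_log R ((cmod (w - of_real t * c))\<^sup>2)) has_real_derivative
       - Re (c * cnj (w - of_real t * c)) / (max (cmod (w - of_real t * c)) R)\<^sup>2) (at t)" for w
    proof (rule back_subst[of "\<lambda>y. (_ has_real_derivative y) (at t)"])
      have "1 / (2 * m) * (- 2 * a) = - a / m" for a m :: real by simp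
      then show "1 / (2 * (max (cmod (w - of_real t * c)) R)\<^sup>2) * (- 2 * Re (c * cnj (w - of_real t * c)))
        = - Re (c * cnj (w - of_real t * c)) / (max (cmod (w - of_real t * c)) R)\<^sup>2" .
    qed
    have 4: "((\<lambda>t. t * a / r\<^sup>2) has_real_derivative a / r\<^sup>2) (at t)" for a
      using DERIV_cdivide[OF DERIV_cmult_right[OF DERIV_ident, of a t], of "r\<^sup>2"] by simp
    have "(\<Phi> has_real_derivative (\<Sum>w\<in>disc 0 r. of_int (D w) *
      (- Re (c * cnj (w - of_real t * c)) / (max (cmod (w - of_real t * c)) R)\<^sup>2 + Re (c * cnj w) / r\<^sup>2))) (at t)"
      unfolding \<Phi>_def by (intro DERIV_sum DERIV_cmult DERIV_add 3 4)
    also have "(\<Sum>w\<in>disc 0 r. of_int (D w) *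
      (- Re (c * cnj (w - of_real t * c)) / (max (cmod (w - of_real t * c)) R)\<^sup>2 + Re (c * cnj w) / r\<^sup>2)) = Re (c * G (of_real t * c))"
      unfolding G_def sum_distrib_left Re_sum
    proof (intro sum.cong refl)
      fix w
      have "of_int n * (- Re (c * b) / q + Re (c * a) / p) = Re (c * (of_int n * (a / of_real p - b / of_real q)))" for n a b p q
        by (simp add: algebra_simps diff_divide_distrib add_divide_distrib)
      then show "of_int (D w) * (- Re (c * cnj (w - of_real t * c)) / (max (cmod (w - of_real t * c)) R)\<^sup>2 + Re (c * cnj w) / r\<^sup>2) =
        Re (c * (of_int (D w) * (cnj w / of_real (r\<^sup>2) - cnj (w - of_real t * c) / of_real ((max (cmod (w - of_real t * c)) R)\<^sup>2))))" .
    qed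
    finally show ?thesis .
  qed
  have "\<bar>Re (c * G (of_real t * c))\<bar> \<le> 6 * Ce + cmod c * ?K" if "0 < t" "t < 1" for t
  proof -
    have "cmod (G (of_real t * c)) \<le> 6 * Ce / R + ?K"
      unfolding G_def using that assms(2) R
      by (intro gradient_le) (auto simp: norm_mult mult_left_le_one_le R_def)
    then have "\<bar>Re (c * G (of_real t * c))\<bar> \<le> cmod c * (6 * Ce / R + ?K)"
      by (intro order_trans[OF abs_Re_le_cmod]) (simp add: norm_mult mult_left_mono)
    also have "\<dots> = cmod c / R * (6 * Ce) + cmod c * ?K" by (simp add: distrib_left)
    also have "cmod c / R * (6 * Ce) \<le> 1 * (6 * Ce)"
      using constants_nonneg R by (intro mult_right_mono) (auto simp: R_def)
    finally show ?thesis by simp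
  qed
  moreover obtain t where "0 < t" "t < 1" "\<Phi> 1 - \<Phi> 0 = (1 - 0) * Re (c * G (of_real t * c))"
    using MVT2[of 0 1 \<Phi>, OF _ deriv] by auto
  ultimately have "\<bar>\<Phi> 1 - \<Phi> 0\<bar> \<le> 6 * Ce + cmod c * ?K" by simp
  moreover have "\<bar>T c + local_log c\<bar> \<le> 3 * Cd + Cb" "\<bar>T 0 + local_log 0\<bar> \<le> 3 * Cd + Cb"
    unfolding T_def by (rule smoothing_le[OF assms(1) R(1)], rule smoothing_le[OF D_0 R(1)])
  ultimately have "\<bar>log_potential c r - local_log c\<bar> \<le> \<bar>local_log 0\<bar> + 6 * Cd + 2 * Cb + 6 * Ce + cmod c * ?K"
    unfolding eq by linarith
  then show ?thesis by simp
qed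

end

section \<open>The canonical product\<close>

locale convergent_divisor = balanced_divisor +
  assumes square_sums: "\<exists>L. ((\<lambda>r. \<Sum>w | D w \<noteq> 0 \<and> 1 \<le> cmod w \<and> cmod w < r. of_int (D w) / w\<^sup>2) \<longlongrightarrow> L) at_top"
begin

section \<open>Convergence of the product\<close>

definition partial_product :: "complex set \<Rightarrow> complex \<Rightarrow> complex" where
  "partial_product A z = (\<Prod>w\<in>A. elementary_factor w z powi D w)"

text \<open>Group the points by m, the integer part of |w|. Such a group lies in an annulus of width
  1, so its mass is at most 9 Cb m and its contribution at most 9 Cb / m^2.\<close>

lemma cubic_summable: "(\<lambda>w. real_of_int \<bar>D w\<bar> / cmod w ^ 3) summable_on {w. D w \<noteq> 0 \<and> 1 \<le> cmod w}"
proof (rule nonneg_bounded_partial_sums_imp_summable_on)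
  let ?X = "{w. D w \<noteq> 0 \<and> 1 \<le> cmod w}" and ?h = "\<lambda>w. real_of_int \<bar>D w\<bar> / cmod w ^ 3"
  let ?g = "\<lambda>w. nat \<lfloor>cmod w\<rfloor>"
  let ?M = "\<lambda>m::nat. 9 * Cb * inverse (real m ^ 2)"
  have M: "summable ?M" by (intro summable_mult inverse_power_summable) auto
  have "sum ?h F \<le> suminf ?M" if F: "finite F" "F \<subseteq> ?X" for F
  proof -
    have "sum ?h F = (\<Sum>m\<in>?g ` F. sum ?h {w\<in>F. ?g w = m})"
      by (rule sum.image_gen[OF F(1)])
    also have "\<dots> \<le> sum ?M (?g ` F)"
    proof (rule sum_mono)
      fix m assume "m \<in> ?g ` F"
      then have "\<exists>w. 1 \<le> cmod w \<and> m = ?g w" using F by blast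
      then have m: "1 \<le> real m" by (auto simp: le_nat_floor)
      have w: "real m \<le> cmod w" "cmod w \<le> real m + 1" if "w \<in> {w\<in>F. ?g w = m}" for w
        using that by auto
      have "sum ?h {w\<in>F. ?g w = m} \<le> (\<Sum>w\<in>{w\<in>F. ?g w = m}. real_of_int \<bar>D w\<bar> / real m ^ 3)"
        using w m by (intro sum_mono divide_left_mono power_mono mult_pos_pos zero_less_power) force+
      also have "\<dots> = (\<Sum>w\<in>{w\<in>F. ?g w = m}. real_of_int \<bar>D w\<bar>) / real m ^ 3"
        by (simp add: sum_divide_distrib)
      also have "\<dots> \<le> (Cb * ((real m + 1 + 1)\<^sup>2 - (real m - 1)\<^sup>2)) / real m ^ 3"
        using w m F by (intro divide_right_mono annulus_mass[of _ _ _ 0]) auto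
      also have "\<dots> \<le> (Cb * (9 * real m)) / real m ^ 3"
        using m constants_nonneg by (intro divide_right_mono mult_left_mono) (auto simp: power2_eq_square algebra_simps)
      also have "\<dots> = ?M m" using m by (simp add: power2_eq_square power3_eq_cube field_simps)
      finally show "sum ?h {w\<in>F. ?g w = m} \<le> ?M m" .
    qed
    also have "\<dots> \<le> suminf ?M"
      using F constants_nonneg by (intro sum_le_suminf M) auto
    finally show ?thesis .
  qed
  then show "eventually (\<lambda>F. sum ?h F \<le> suminf ?M) (finite_subsets_at_top ?X)"
    by (auto simp: eventually_finite_subsets_at_top_weakI)
qed auto

text \<open>Beyond 2 \<rho> + 1 every |z / w| is at most 1 / 2, so the logarithm splits into -(z /
  w)^2 / 2 and a cubic remainder. The remainders converge by the Weierstrass M-test, the quadratic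
  terms by (f).\<close>

lemma uniform_limit_tail:
  assumes "0 < \<rho>"
  obtains E where "E holomorphic_on ball 0 \<rho>"
    and "\<And>z. z \<in> ball 0 \<rho> \<Longrightarrow>
      ((\<lambda>r. \<Sum>w\<in>disc 0 r - disc 0 (2 * \<rho> + 1). of_int (D w) * (Ln (1 - z / w) + z / w)) \<longlongrightarrow> E z) at_top"
proof -
  define B where "B = {w. D w \<noteq> 0} - disc 0 (2 * \<rho> + 1)"
  define A where "A r = disc 0 r - disc 0 (2 * \<rho> + 1)" for r
  define h where "h u = Ln (1 - u) + u + u\<^sup>2 / 2" for u :: complex
  have small: "cmod (z / w) \<le> 1 / 2" and large: "1 \<le> cmod w" "2 * \<rho> < cmod w" if "w \<in> B" "z \<in> cball 0 \<rho>" for w z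
  proof -
    show w: "1 \<le> cmod w" "2 * \<rho> < cmod w" using that assms by (auto simp: B_def disc_def)
    show "cmod (z / w) \<le> 1 / 2"
      using that(2) w assms by (simp add: norm_divide divide_le_eq)
  qed
  have B1: "B \<subseteq> {w. D w \<noteq> 0 \<and> 1 \<le> cmod w}"
    using large[of _ 0] assms by (auto simp: B_def)
  \<comment> \<open>The truncations by modulus exhaust B, so the unordered sum over B is also their
    limit.\<close>
  have A_top: "filterlim A (finite_subsets_at_top B) at_top"
    unfolding filterlim_finite_subsets_at_top
  proof (intro allI impI)
    fix X assume X: "finite X \<and> X \<subseteq> B"
    then obtain s where s: "\<And>w. w \<in> X \<Longrightarrow> cmod w < s"
      using finite_imp_bounded[of X] bounded_pos_less[of X] by blast
    show "eventually (\<lambda>r. finite (A r) \<and> X \<subseteq> A r \<and> A r \<subseteq> B) at_top"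
      using eventually_ge_at_top[of s]
    proof eventually_elim
      case (elim r)
      have "X \<subseteq> A r" using X s elim by (force simp: A_def B_def disc_def)
      moreover have "finite (A r)" by (simp add: A_def finite_disc)
      moreover have "A r \<subseteq> B" by (auto simp: A_def B_def disc_def)
      ultimately show ?case by blast
    qed
  qed
  have bound: "cmod (of_int (D w) * h (z / w)) \<le> real_of_int \<bar>D w\<bar> / cmod w ^ 3 * (2 * \<rho> ^ 3)"
    if "w \<in> B" "z \<in> cball 0 \<rho>" for w z
  proof -
    have "cmod (h (z / w)) \<le> 2 * cmod (z / w) ^ 3"
      unfolding h_def by (rule Ln_taylor_bound[OF small[OF that]])
    also have "\<dots> \<le> 2 * (\<rho> ^ 3 / cmod w ^ 3)"
      using that(2) by (simp add: norm_divide power_divide divide_right_mono power_mono)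
    finally have "cmod (of_int (D w) * h (z / w)) \<le> \<bar>real_of_int (D w)\<bar> * (2 * (\<rho> ^ 3 / cmod w ^ 3))"
      by (simp only: norm_mult norm_of_int mult_left_mono abs_ge_zero)
    then show ?thesis by (simp add: mult_ac)
  qed
  define H where "H z = (\<Sum>\<^sub>\<infinity>w\<in>B. of_int (D w) * h (z / w))" for z
  have "uniform_limit (cball 0 \<rho>) (\<lambda>X z. \<Sum>w\<in>X. of_int (D w) * h (z / w)) H (finite_subsets_at_top B)"
    unfolding H_def
    by (intro Weierstrass_m_test_general[OF bound] summable_on_cmult_left
        summable_on_subset_banach[OF cubic_summable B1])
  then have uni: "uniform_limit (cball 0 \<rho>) (\<lambda>r z. \<Sum>w\<in>A r. of_int (D w) * h (z / w)) H at_top"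
    by (rule filterlim_compose[OF _ A_top])
  have Hhol: "H holomorphic_on ball 0 \<rho>"
  proof (rule holomorphic_uniform_limit[OF _ uni])
    have hol: "(\<lambda>z. \<Sum>w\<in>A r. of_int (D w) * h (z / w)) holomorphic_on cball 0 \<rho>" for r
      unfolding h_def
    proof (intro holomorphic_intros)
      fix w z :: complex assume "w \<in> A r" "z \<in> cball 0 \<rho>"
      then have "cmod (z / w) \<le> 1 / 2" by (intro small) (auto simp: A_def B_def disc_def)
      moreover have "Re (z / w) \<le> cmod (z / w)" by (rule complex_Re_le_cmod)
      ultimately show "1 - z / w \<notin> \<real>\<^sub>\<le>\<^sub>0" by (auto simp: complex_nonpos_Reals_iff)
    qed (auto simp: A_def disc_def D_0)
    show "\<forall>\<^sub>F r in at_top. continuous_on (cball 0 \<rho>) (\<lambda>z. \<Sum>w\<in>A r. of_int (D w) * h (z / w)) \<and>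
        (\<lambda>z. \<Sum>w\<in>A r. of_int (D w) * h (z / w)) holomorphic_on ball 0 \<rho>"
      by (intro always_eventually allI conjI holomorphic_on_imp_continuous_on hol
          holomorphic_on_subset[OF hol ball_subset_cball])
  qed auto
  obtain L where L: "((\<lambda>r. \<Sum>w | D w \<noteq> 0 \<and> 1 \<le> cmod w \<and> cmod w < r. of_int (D w) / w\<^sup>2) \<longlongrightarrow> L) at_top"
    using square_sums by blast
  \<comment> \<open>The finite part of the sum in (f) that belongs to the head of the
    product.\<close>
  define c where "c = (\<Sum>w | D w \<noteq> 0 \<and> 1 \<le> cmod w \<and> cmod w < 2 * \<rho> + 1. of_int (D w) / w\<^sup>2)"
  have "eventually (\<lambda>r. (\<Sum>w | D w \<noteq> 0 \<and> 1 \<le> cmod w \<and> cmod w < r. of_int (D w) / w\<^sup>2) - c = (\<Sum>w\<in>A r. of_int (D w) / w\<^sup>2)) at_top"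
    using eventually_ge_at_top[of "2 * \<rho> + 1"]
  proof eventually_elim
    case (elim r)
    let ?D = "\<lambda>r. {w. D w \<noteq> 0 \<and> 1 \<le> cmod w \<and> cmod w < r}"
    have "A r = ?D r - ?D (2 * \<rho> + 1)" using assms by (auto simp: A_def disc_def)
    moreover have "finite (?D r)" by (rule finite_subset[OF _ finite_disc[of 0 r]]) (auto simp: disc_def)
    moreover have "?D (2 * \<rho> + 1) \<subseteq> ?D r" using elim by auto
    ultimately show ?case by (simp add: c_def sum_diff)
  qed
  from tendsto_diff[OF L tendsto_const[of c]] this have sq: "((\<lambda>r. \<Sum>w\<in>A r. of_int (D w) / w\<^sup>2) \<longlongrightarrow> L - c) at_top"
    by (rule Lim_transform_eventually)
  show thesis
  proof (rule that[of "\<lambda>z. H z - z\<^sup>2 / 2 * (L - c)"])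
    show "(\<lambda>z. H z - z\<^sup>2 / 2 * (L - c)) holomorphic_on ball 0 \<rho>"
      by (intro holomorphic_intros Hhol) auto
    fix z :: complex assume "z \<in> ball 0 \<rho>"
    then have "((\<lambda>r. (\<Sum>w\<in>A r. of_int (D w) * h (z / w)) - z\<^sup>2 / 2 * (\<Sum>w\<in>A r. of_int (D w) / w\<^sup>2)) \<longlongrightarrow>
        H z - z\<^sup>2 / 2 * (L - c)) at_top"
      by (intro tendsto_intros sq tendsto_uniform_limitI[OF uni]) auto
    moreover have "(\<Sum>w\<in>A r. of_int (D w) * h (z / w)) - z\<^sup>2 / 2 * (\<Sum>w\<in>A r. of_int (D w) / w\<^sup>2) =
       (\<Sum>w\<in>A r. of_int (D w) * (Ln (1 - z / w) + z / w))" for r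
      unfolding sum_distrib_left sum_subtractf[symmetric] h_def
      by (intro sum.cong refl) (simp add: power_divide algebra_simps)
    ultimately show "((\<lambda>r. \<Sum>w\<in>disc 0 r - disc 0 (2 * \<rho> + 1). of_int (D w) * (Ln (1 - z / w) + z / w)) \<longlongrightarrow>
        H z - z\<^sup>2 / 2 * (L - c)) at_top"
      by (simp add: A_def)
  qed
qed

text \<open>On the disc the tail factors have no zeros and are exponentials of their logarithms; the
  finite head carries all zeros and poles there. At a pole \<open>0 powi D w\<close> is 0, so
  convergence holds at that point too.\<close>

lemma partial_product_converges:
  assumes "0 < \<rho>"
  obtains E where "E holomorphic_on ball 0 \<rho>"
    and "\<And>z. z \<in> ball 0 \<rho> \<Longrightarrow>
      ((\<lambda>r. partial_product (disc 0 r) z) \<longlongrightarrow> partial_product (disc 0 (2 * \<rho> + 1)) z * exp (E z)) at_top"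
proof -
  obtain E where E: "E holomorphic_on ball 0 \<rho>" "\<And>z. z \<in> ball 0 \<rho> \<Longrightarrow>
      ((\<lambda>r. \<Sum>w\<in>disc 0 r - disc 0 (2 * \<rho> + 1). of_int (D w) * (Ln (1 - z / w) + z / w)) \<longlongrightarrow> E z) at_top"
    by (rule uniform_limit_tail[OF assms]) (use that in blast)
  show thesis
  proof (rule that[OF E(1)])
    fix z :: complex assume z: "z \<in> ball 0 \<rho>"
    let ?A = "disc 0 (2 * \<rho> + 1)"
    let ?T = "\<lambda>r. \<Sum>w\<in>disc 0 r - ?A. of_int (D w) * (Ln (1 - z / w) + z / w)"
    have factor: "elementary_factor w z powi D w = exp (of_int (D w) * (Ln (1 - z / w) + z / w))"
      if "w \<in> disc 0 r - ?A" for w r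
    proof -
      have "2 * \<rho> + 1 \<le> cmod w" using that by (auto simp: disc_def)
      then have "z \<noteq> w" using z assms by auto
      then have "1 - z / w \<noteq> 0" by auto
      then have "elementary_factor w z = exp (Ln (1 - z / w) + z / w)"
        by (simp add: elementary_factor_def exp_add)
      then show ?thesis by (simp add: exp_power_int)
    qed
    have "eventually (\<lambda>r. partial_product ?A z * exp (?T r) = partial_product (disc 0 r) z) at_top"
      using eventually_ge_at_top[of "2 * \<rho> + 1"]
    proof eventually_elim
      case (elim r)
      have "partial_product (disc 0 r) z = partial_product (disc 0 r - ?A) z * partial_product ?A z"
        unfolding partial_product_def by (rule prod.subset_diff[OF disc_mono[OF elim] finite_disc])
      also have "partial_product (disc 0 r - ?A) z = exp (?T r)"
        unfolding partial_product_def by (subst prod.cong[OF refl factor[of _ r]]) (simp_all add: exp_sum finite_disc)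
      finally show ?case by simp
    qed
    moreover have "((\<lambda>r. partial_product ?A z * exp (?T r)) \<longlongrightarrow> partial_product ?A z * exp (E z)) at_top"
      by (intro tendsto_intros E(2) z)
    ultimately show "((\<lambda>r. partial_product (disc 0 r) z) \<longlongrightarrow> partial_product ?A z * exp (E z)) at_top"
      by (rule Lim_transform_eventually[rotated])
  qed
qed


section \<open>The limit function and its divisor\<close>

lemma is_divisor: "is_divisor D"
  using locally_finite by (simp add: is_divisor_def)

text \<open>Here \<alpha> is a free parameter: the divisor is the same for every \<alpha>, and only
  the growth bounds relate it to the limit of \<open>drift\<close>.\<close>

definition limit_function :: "complex \<Rightarrow> complex \<Rightarrow> complex" where
  "limit_function \<alpha> z = exp (\<alpha> * z) * Lim at_top (\<lambda>r. partial_product (disc 0 r) z)"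

lemma partial_product_tendsto:
  "((\<lambda>r. partial_product (disc 0 r) z) \<longlongrightarrow> Lim at_top (\<lambda>r. partial_product (disc 0 r) z)) at_top"
proof -
  obtain E where "\<And>x. x \<in> ball 0 (cmod z + 1) \<Longrightarrow> ((\<lambda>r. partial_product (disc 0 r) x) \<longlongrightarrow>
      partial_product (disc 0 (2 * (cmod z + 1) + 1)) x * exp (E x)) at_top"
    by (rule partial_product_converges[of "cmod z + 1"]) (use norm_ge_zero[of z] in \<open>auto simp: add_nonneg_pos\<close>)
  then have "((\<lambda>r. partial_product (disc 0 r) z) \<longlongrightarrow>
      partial_product (disc 0 (2 * (cmod z + 1) + 1)) z * exp (E z)) at_top"
    by simp
  then show ?thesis by (metis tendsto_Lim trivial_limit_at_top_linorder)
qed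

text \<open>Near c the factor belonging to c is split off from the finite head; the rest of the head
  and both exponentials are holomorphic and zero-free there.\<close>

lemma limit_function_meromorphic: "meromorphic_with_divisor (limit_function \<alpha>) D"
  unfolding meromorphic_with_divisor_def
proof
  fix c
  define \<rho> where "\<rho> = cmod c + 1"
  have \<rho>: "0 < \<rho>" by (simp add: \<rho>_def add_nonneg_pos)
  define A where "A = disc 0 (2 * \<rho> + 1)"
  obtain E where E: "E holomorphic_on ball 0 \<rho>"
    and lim: "\<And>z. z \<in> ball 0 \<rho> \<Longrightarrow> ((\<lambda>r. partial_product (disc 0 r) z) \<longlongrightarrow> partial_product A z * exp (E z)) at_top"
    unfolding A_def by (rule partial_product_converges[OF \<rho>]) (use that in blast)
  obtain s where s: "0 < s" "\<And>w. w \<in> ball c s \<Longrightarrow> w \<noteq> c \<Longrightarrow> D w = 0"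
    using divisor_isolated[OF is_divisor] by blast
  define r where "r = min s 1"
  have r: "0 < r" using s by (simp add: r_def)
  have sub: "ball c r \<subseteq> ball 0 \<rho>"
  proof
    fix w assume "w \<in> ball c r"
    then show "w \<in> ball 0 \<rho>"
      using norm_triangle_sub[of w c] by (simp add: r_def \<rho>_def dist_norm norm_minus_commute)
  qed
  have fac: "partial_product A z = elementary_factor c z powi D c * partial_product (A - {c}) z" for z
  proof (cases "c \<in> A")
    case True
    then show ?thesis unfolding partial_product_def
      by (intro prod.remove) (auto simp: A_def finite_disc)
  next
    case False
    then have "D c = 0" using norm_ge_zero[of c] by (auto simp: A_def disc_def \<rho>_def simp del: norm_ge_zero)
    with False show ?thesis by simp
  qed
  \<comment> \<open>\<open>u\<close> is what remains of the elementary factor after dividing by z -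
    c. For c = 0 the exponent \<open>D c\<close> is 0, so both powers are 1.\<close>
  define u where "u z = - exp (z / c) / c" for z
  have u: "elementary_factor c z powi D c = (z - c) powi D c * u z powi D c" for z
  proof (cases "c = 0")
    case True
    then show ?thesis by (simp add: D_0)
  next
    case False
    then have "elementary_factor c z = (z - c) * u z"
      by (simp add: elementary_factor_def u_def field_simps)
    then show ?thesis by (simp add: power_int_mult_distrib)
  qed
  define g where "g z = u z powi D c * (partial_product (A - {c}) z * exp (\<alpha> * z + E z))" for z
  have nz: "elementary_factor w z \<noteq> 0" if "w \<in> A - {c}" "z \<in> ball c r" for w z
  proof -
    have "D w \<noteq> 0" "w \<noteq> c" using that by (auto simp: A_def disc_def)
    with s(2)[of z] that(2) have "z \<noteq> w" by (auto simp: r_def)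
    moreover have "w \<noteq> 0" using \<open>D w \<noteq> 0\<close> D_0 by auto
    ultimately show ?thesis by (simp add: elementary_factor_def)
  qed
  have w0: "w \<noteq> 0" if "w \<in> A" for w using that D_0 by (auto simp: A_def disc_def)
  have "g holomorphic_on ball c r"
  proof -
    have "(\<lambda>z. u z powi D c) holomorphic_on ball c r"
    proof (cases "c = 0")
      case True then show ?thesis by (simp add: D_0)
    next
      case False then show ?thesis unfolding u_def by (intro holomorphic_intros) auto
    qed
    moreover have "(\<lambda>z. partial_product (A - {c}) z) holomorphic_on ball c r"
      unfolding partial_product_def
    proof (intro holomorphic_intros)
      fix w assume w: "w \<in> A - {c}"
      show "elementary_factor w holomorphic_on ball c r"
        unfolding elementary_factor_def using w0 w by (intro holomorphic_intros) auto
      show "0 \<le> D w \<or> (\<forall>z\<in>ball c r. elementary_factor w z \<noteq> 0)" using nz w by blast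
    qed
    moreover have "(\<lambda>z. exp (\<alpha> * z + E z)) holomorphic_on ball c r"
      by (intro holomorphic_intros holomorphic_on_subset[OF E sub])
    ultimately show ?thesis
      unfolding g_def by (intro holomorphic_on_mult)
  qed
  moreover have "g c \<noteq> 0"
  proof -
    have "u c powi D c \<noteq> 0" by (cases "c = 0") (simp_all add: D_0 u_def)
    moreover have "partial_product (A - {c}) c \<noteq> 0"
      unfolding partial_product_def using nz[of _ c] r by (subst prod_zero_iff) (auto simp: A_def finite_disc)
    ultimately show ?thesis by (simp add: g_def)
  qed
  moreover have "limit_function \<alpha> w = (w - c) powi D c * g w" if "w \<in> ball c r" for w
  proof -
    have "Lim at_top (\<lambda>r. partial_product (disc 0 r) w) = partial_product A w * exp (E w)"
      using lim[of w] sub that by (intro tendsto_Lim) auto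
    then show ?thesis by (simp add: limit_function_def g_def fac u exp_add mult_ac)
  qed
  ultimately show "\<exists>r>0. \<exists>g. g holomorphic_on ball c r \<and> g c \<noteq> 0 \<and>
      (\<forall>w\<in>ball c r. (w \<noteq> c \<or> 0 \<le> D c) \<longrightarrow> limit_function \<alpha> w = (w - c) powi D c * g w)"
    using r by blast
qed

section \<open>Size of the limit function and normality\<close>

lemma limit_function_zero: "0 < D z \<Longrightarrow> limit_function \<alpha> z = 0"
proof -
  assume D: "0 < D z"
  obtain r g where "0 < r" "\<forall>w\<in>ball z r. (w \<noteq> z \<or> 0 \<le> D z) \<longrightarrow> limit_function \<alpha> w = (w - z) powi D z * g w"
    using limit_function_meromorphic[of \<alpha>] unfolding meromorphic_with_divisor_def by blast
  with D show ?thesis by simp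
qed

lemma norm_partial_product:
  assumes "D c = 0"
  shows "cmod (exp (- drift r * c) * partial_product (disc 0 r) c) = exp (log_potential c r)"
proof -
  have factor: "cmod (elementary_factor w c powi D w) = exp (of_int (D w) * (ln (cmod (w - c)) - ln (cmod w) + Re (c / w)))"
    if "w \<in> disc 0 r" for w
  proof -
    have w: "w \<noteq> 0" "w \<noteq> c" using that assms D_0 by (auto simp: disc_def)
    have "1 - c / w = (w - c) / w" using w by (simp add: field_simps)
    then have "cmod (elementary_factor w c) = cmod (w - c) / cmod w * exp (Re (c / w))"
      by (simp only: elementary_factor_def norm_mult norm_divide norm_exp_eq_Re)
    also have "\<dots> = exp (ln (cmod (w - c)) - ln (cmod w) + Re (c / w))"
      using w by (simp add: exp_add exp_diff)
    finally show ?thesis by (simp add: norm_power_int exp_power_int)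
  qed
  have "cmod (partial_product (disc 0 r) c) =
      exp (\<Sum>w\<in>disc 0 r. of_int (D w) * (ln (cmod (w - c)) - ln (cmod w) + Re (c / w)))"
    unfolding partial_product_def prod_norm[symmetric] by (simp add: exp_sum finite_disc factor)
  then have "cmod (exp (- drift r * c) * partial_product (disc 0 r) c) =
      exp (Re (- drift r * c) + (\<Sum>w\<in>disc 0 r. of_int (D w) * (ln (cmod (w - c)) - ln (cmod w) + Re (c / w))))"
    by (simp only: norm_mult norm_exp_eq_Re exp_add)
  \<comment> \<open>Written over the same points, the drift cancels the terms Re (c / w) coming from
    the exponentials in the factors.\<close>
  also have "Re (- drift r * c) = (\<Sum>w\<in>disc 0 r. of_int (D w) * (Re (c * cnj w) / r\<^sup>2 - Re (c / w)))"
  proof -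
    have "- drift r * c = (\<Sum>w\<in>disc 0 r. of_int (D w) * (c * cnj w / of_real (r\<^sup>2) - c / w))"
      unfolding drift_def sum_distrib_right sum_negf[symmetric] by (intro sum.cong refl) (simp add: algebra_simps)
    moreover have "Re (of_int n * (a / of_real q - b)) = of_int n * (Re a / q - Re b)" for n a q b
      by simp
    ultimately show ?thesis by (simp only: Re_sum)
  qed
  also have "(\<Sum>w\<in>disc 0 r. of_int (D w) * (Re (c * cnj w) / r\<^sup>2 - Re (c / w))) +
      (\<Sum>w\<in>disc 0 r. of_int (D w) * (ln (cmod (w - c)) - ln (cmod w) + Re (c / w))) = log_potential c r"
    unfolding log_potential_def sum.distrib[symmetric] distrib_left[symmetric] by (intro sum.cong refl) simp
  finally show ?thesis .
qed

text \<open>Let r tend to infinity in \<open>log_potential_le\<close>: its error that depends on c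
  carries a factor 1 / r and disappears, so M is the same for all c.\<close>

lemma limit_function_bounds:
  assumes "(drift \<longlongrightarrow> - \<alpha>) at_top"
  obtains M where "\<And>c. D c = 0 \<Longrightarrow> exp (local_log c - M) \<le> cmod (limit_function \<alpha> c)"
    "\<And>c. D c = 0 \<Longrightarrow> cmod (limit_function \<alpha> c) \<le> exp (local_log c + M)"
proof -
  define M where "M = \<bar>local_log 0\<bar> + 6 * Cd + 2 * Cb + 6 * Ce"
  have "exp (local_log c - M) \<le> cmod (limit_function \<alpha> c) \<and> cmod (limit_function \<alpha> c) \<le> exp (local_log c + M)"
    if c: "D c = 0" for c
  proof
    define K where "K = cmod c * (cmod c * charge_const + 16 * Cb * cmod c * (cmod c + 1))"
    have "((\<lambda>r. cmod (exp (- drift r * c) * partial_product (disc 0 r) c)) \<longlongrightarrow> cmod (exp (- (- \<alpha>) * c) * Lim at_top (\<lambda>r. partial_product (disc 0 r) c))) at_top"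
      by (intro tendsto_intros assms partial_product_tendsto)
    then have lim: "((\<lambda>r. exp (log_potential c r)) \<longlongrightarrow> cmod (limit_function \<alpha> c)) at_top"
      by (simp add: norm_partial_product[OF c, simplified] limit_function_def)
    have K: "((\<lambda>r. K / r) \<longlongrightarrow> 0) at_top"
      by (intro tendsto_divide_0[OF tendsto_const] filterlim_at_top_imp_at_infinity filterlim_ident)
    have ev: "eventually (\<lambda>r. \<bar>log_potential c r - local_log c\<bar> \<le> M + K / r) at_top"
      using eventually_ge_at_top[of "3 * cmod c + 3"]
      by eventually_elim (use log_potential_le[OF c] in \<open>simp add: M_def K_def\<close>)
    have "((\<lambda>r. exp (local_log c + (M + K / r))) \<longlongrightarrow> exp (local_log c + (M + 0))) at_top"
      by (intro tendsto_intros K)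
    moreover have "eventually (\<lambda>r. exp (log_potential c r) \<le> exp (local_log c + (M + K / r))) at_top"
      using ev by eventually_elim (auto simp: abs_le_iff algebra_simps)
    ultimately show "cmod (limit_function \<alpha> c) \<le> exp (local_log c + M)"
      using tendsto_le[OF trivial_limit_at_top_linorder _ lim] by fastforce
    have "((\<lambda>r. exp (local_log c - (M + K / r))) \<longlongrightarrow> exp (local_log c - (M + 0))) at_top"
      by (intro tendsto_intros K)
    moreover have "eventually (\<lambda>r. exp (local_log c - (M + K / r)) \<le> exp (log_potential c r)) at_top"
      using ev by eventually_elim (auto simp: abs_le_iff algebra_simps)
    ultimately show "exp (local_log c - M) \<le> cmod (limit_function \<alpha> c)"
      using tendsto_le[OF trivial_limit_at_top_linorder lim] by fastforce
  qed
  then show thesis using that by blast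
qed

text \<open>Within distance 1 of c the logarithms are negative, so zeros only lower
  \<open>local_log\<close> and poles only raise it. If the points of the harmful sign keep distance
  \<eta>, each unit of their mass costs at most ln (1 / \<eta>), and (b) bounds the mass.\<close>

lemma local_log_bounds:
  assumes "D c = 0" "0 < \<eta>" "\<eta> \<le> 1"
  shows "(\<And>w. D w < 0 \<Longrightarrow> \<eta> \<le> cmod (w - c)) \<Longrightarrow> local_log c \<le> Cb * ln (1 / \<eta>)"
    and "(\<And>w. 0 < D w \<Longrightarrow> \<eta> \<le> cmod (w - c)) \<Longrightarrow> - local_log c \<le> Cb * ln (1 / \<eta>)"
proof -
  have mass: "(\<Sum>w\<in>disc c 1. \<bar>of_int (D w)\<bar> * ln (1 / \<eta>)) \<le> Cb * ln (1 / \<eta>)"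
  proof -
    have "(\<Sum>w\<in>disc c 1. real_of_int \<bar>D w\<bar>) \<le> (\<Sum>w | D w \<noteq> 0 \<and> cmod (w - c) \<le> 1. real_of_int \<bar>D w\<bar>)"
      by (intro sum_mono2 finite_cdisc) (auto simp: disc_def)
    also have "\<dots> \<le> Cb" by (rule density)
    finally have "(\<Sum>w\<in>disc c 1. real_of_int \<bar>D w\<bar>) * ln (1 / \<eta>) \<le> Cb * ln (1 / \<eta>)"
      using assms by (intro mult_right_mono) (auto simp: ln_div)
    then show ?thesis by (simp only: sum_distrib_right of_int_abs)
  qed
  have key: "n * ln x \<le> \<bar>n\<bar> * ln (1 / \<eta>)" if "0 < x" "x < 1" "n < 0 \<Longrightarrow> \<eta> \<le> x" for n x :: real
  proof (cases "n < 0")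
    case True
    have "- ln x \<le> ln (1 / \<eta>)" using that(3)[OF True] assms(2) that(1) by (simp add: ln_div)
    then show ?thesis using True mult_left_mono[of "- ln x" "ln (1 / \<eta>)" "- n"] by simp
  next
    case False
    have "n * ln x \<le> 0" using False that by (simp add: mult_nonneg_nonpos)
    also have "0 \<le> \<bar>n\<bar> * ln (1 / \<eta>)" using assms by (intro mult_nonneg_nonneg) (auto simp: ln_div)
    finally show ?thesis .
  qed
  have pos: "0 < cmod (w - c)" "cmod (w - c) < 1" if "w \<in> disc c 1" for w
    using that assms by (auto simp: disc_def)
  show "local_log c \<le> Cb * ln (1 / \<eta>)" if "\<And>w. D w < 0 \<Longrightarrow> \<eta> \<le> cmod (w - c)"
    unfolding local_log_def using pos that by (intro order_trans[OF sum_mono mass] key) auto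
  have "(\<Sum>w\<in>disc c 1. - of_int (D w) * ln (cmod (w - c))) \<le> Cb * ln (1 / \<eta>)"
    if "\<And>w. 0 < D w \<Longrightarrow> \<eta> \<le> cmod (w - c)"
  proof (rule order_trans[OF sum_mono mass])
    fix w assume "w \<in> disc c 1"
    then show "- of_int (D w) * ln (cmod (w - c)) \<le> \<bar>of_int (D w)\<bar> * ln (1 / \<eta>)"
      using key[of "cmod (w - c)" "- of_int (D w)"] pos that[of w] by simp
  qed
  then show "- local_log c \<le> Cb * ln (1 / \<eta>)" if "\<And>w. 0 < D w \<Longrightarrow> \<eta> \<le> cmod (w - c)"
    unfolding local_log_def using that by (simp add: sum_negf)
qed

lemma limit_function_normal:
  assumes "(drift \<longlongrightarrow> - \<alpha>) at_top"
    and "0 < \<delta>" "\<And>x y. 0 < D x \<Longrightarrow> D y < 0 \<Longrightarrow> \<delta> \<le> cmod (x - y)"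
  shows "normal_function (\<lambda>z. if D z < 0 then None else Some (limit_function \<alpha> z))"
proof -
  \<comment> \<open>A disc of radius 2 \<eta> has diameter at most \<delta>, so by (a) it cannot
    contain both a zero and a pole. Points of its concentric half are at least \<eta> away from
    everything outside it.\<close>
  define \<eta> where "\<eta> = min 1 (\<delta> / 4)"
  have \<eta>: "0 < \<eta>" "\<eta> \<le> 1" "4 * \<eta> \<le> \<delta>" using assms(2) by (auto simp: \<eta>_def)
  obtain M0 where M0: "\<And>c. D c = 0 \<Longrightarrow> exp (local_log c - M0) \<le> cmod (limit_function \<alpha> c)"
    "\<And>c. D c = 0 \<Longrightarrow> cmod (limit_function \<alpha> c) \<le> exp (local_log c + M0)"
    by (rule limit_function_bounds[OF assms(1)]) (use that in blast)
  define M where "M = exp (Cb * ln (1 / \<eta>) + M0)"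
  have M: "1 / M = exp (- (Cb * ln (1 / \<eta>)) - M0)"
    by (simp add: M_def exp_minus[symmetric] divide_inverse)
  show ?thesis
  proof (rule normal_function_of_local_bounds[OF limit_function_meromorphic is_divisor \<eta>(1)])
    show "0 < M" by (simp add: M_def)
    fix c
    have far: "\<eta> \<le> cmod (w - z)" if "z \<in> ball c \<eta>" "w \<notin> ball c (2 * \<eta>)" for w z
      using that norm_triangle_ineq[of "c - z" "z - w"] by (simp add: dist_norm norm_minus_commute)
    consider (zeros) "\<forall>w\<in>ball c (2 * \<eta>). 0 \<le> D w" | (poles) "\<forall>w\<in>ball c (2 * \<eta>). D w \<le> 0"
    proof (cases "\<exists>w\<in>ball c (2 * \<eta>). D w < 0")
      case True
      then obtain y where y: "y \<in> ball c (2 * \<eta>)" "D y < 0" by blast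
      have "D x \<le> 0" if "x \<in> ball c (2 * \<eta>)" for x
      proof (rule ccontr)
        assume "\<not> D x \<le> 0"
        then have "\<delta> \<le> cmod (x - y)" using assms(3) y by auto
        moreover have "dist x y < 2 * \<eta> + 2 * \<eta>"
          using that y dist_triangle3[of x y c] by simp
        ultimately show False using \<eta> by (simp add: dist_norm)
      qed
      then show thesis using poles by blast
    qed (use zeros in force)
    then show "(\<forall>z\<in>ball c \<eta>. 0 \<le> D z \<and> cmod (limit_function \<alpha> z) \<le> M) \<or>
               (\<forall>z\<in>ball c \<eta>. D z \<le> 0 \<and> (D z = 0 \<longrightarrow> 1 / M \<le> cmod (limit_function \<alpha> z)))"
    proof cases
      case zeros
      have "0 \<le> D z \<and> cmod (limit_function \<alpha> z) \<le> M" if z: "z \<in> ball c \<eta>" for z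
      proof
        show "0 \<le> D z" using zeros z \<eta> by auto
        then consider "0 < D z" | "D z = 0" by linarith
        then show "cmod (limit_function \<alpha> z) \<le> M"
        proof cases
          case 2
          have "local_log z \<le> Cb * ln (1 / \<eta>)"
            using zeros far[OF z] by (intro local_log_bounds(1)[OF 2 \<eta>(1,2)]) force
          then show ?thesis using M0(2)[OF 2] by (simp add: M_def order_trans)
        qed (simp add: limit_function_zero M_def)
      qed
      then show ?thesis by blast
    next
      case poles
      have "D z \<le> 0 \<and> (D z = 0 \<longrightarrow> 1 / M \<le> cmod (limit_function \<alpha> z))" if z: "z \<in> ball c \<eta>" for z
      proof (intro conjI impI)
        show "D z \<le> 0" using poles z \<eta> by auto
        assume 0: "D z = 0"
        have "- local_log z \<le> Cb * ln (1 / \<eta>)"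
          using poles far[OF z] by (intro local_log_bounds(2)[OF 0 \<eta>(1,2)]) force
        then show "1 / M \<le> cmod (limit_function \<alpha> z)"
          unfolding M by (intro order_trans[OF _ M0(1)[OF 0]]) simp
      qed
      then show ?thesis by blast
    qed
  qed
qed

end

section \<open>The theorem\<close>

lemma sum_positive_minus_negative:
  fixes D :: "'a \<Rightarrow> int" and g :: "'a \<Rightarrow> 'b::ring_1"
  assumes "finite {z. D z \<noteq> 0 \<and> P z}"
  shows "(\<Sum>z\<in>{z. D z > 0 \<and> P z}. of_int (D z) * g z) - (\<Sum>z\<in>{z. D z < 0 \<and> P z}. of_int (- D z) * g z)
    = (\<Sum>z | D z \<noteq> 0 \<and> P z. of_int (D z) * g z)"
proof -
  have eq: "{z. D z \<noteq> 0 \<and> P z} = {z. D z > 0 \<and> P z} \<union> {z. D z < 0 \<and> P z}" by auto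
  have "finite {z. D z > 0 \<and> P z}" "finite {z. D z < 0 \<and> P z}"
    by (rule finite_subset[OF _ assms]; force)+
  then show ?thesis
    unfolding eq by (subst sum.union_disjoint) (auto simp: sum_negf)
qed

text \<open>A point z enters the counting sum as soon as t exceeds |z - c|, so after exchanging sum
  and integral its weight is the integral of 1 / t from there on.\<close>

lemma has_integral_radial_sum:
  fixes g :: "complex \<Rightarrow> complex"
  assumes "finite {z. D z \<noteq> 0 \<and> cmod (z - c) < r}" "1 < r"
  shows "((\<lambda>t. (\<Sum>z | D z \<noteq> 0 \<and> cmod (z - c) < t. of_int (D z) * g z) / of_real t) has_integral
    (\<Sum>z | D z \<noteq> 0 \<and> cmod (z - c) < r. of_int (D z) * g z * of_real (log_cutoff r (cmod (z - c))))) {1..r}"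
proof -
  let ?A = "{z. D z \<noteq> 0 \<and> cmod (z - c) < r}"
  have "((\<lambda>t. \<Sum>z\<in>?A. of_int (D z) * g z * of_real (if cmod (z - c) < t then 1 / t else 0)) has_integral
    (\<Sum>z\<in>?A. of_int (D z) * g z * of_real (log_cutoff r (cmod (z - c))))) {1..r}"
    using assms by (intro has_integral_sum has_integral_mult_right has_integral_of_real log_cutoff_has_integral_inverse) auto
  then show ?thesis
  proof (rule has_integral_eq[rotated])
    fix t assume t: "t \<in> {1..r}"
    have "(\<Sum>z | D z \<noteq> 0 \<and> cmod (z - c) < t. of_int (D z) * g z) / of_real t =
      (\<Sum>z | D z \<noteq> 0 \<and> cmod (z - c) < t. of_int (D z) * g z * of_real (1 / t))"
      by (simp add: sum_divide_distrib)
    also have "\<dots> = (\<Sum>z\<in>?A. of_int (D z) * g z * of_real (if cmod (z - c) < t then 1 / t else 0))"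
      using t by (intro sum.mono_neutral_cong_left assms) auto
    finally show "(\<Sum>z\<in>?A. of_int (D z) * g z * of_real (if cmod (z - c) < t then 1 / t else 0)) =
      (\<Sum>z | D z \<noteq> 0 \<and> cmod (z - c) < t. of_int (D z) * g z) / of_real t" ..
  qed
qed

theorem mainTheorem3:
  fixes D :: "complex \<Rightarrow> int"
  assumes div: "is_divisor D"
    and nonzero: "D 0 = 0"
    and a: "\<exists>\<delta>>0. \<forall>x y. D x > 0 \<longrightarrow> D y < 0 \<longrightarrow> \<delta> \<le> cmod (x - y)"
    and b: "\<exists>C::real. \<forall>c. real_of_int (\<Sum>z\<in>{z. D z > 0 \<and> cmod (z - c) \<le> 1}. D z)
                        + real_of_int (\<Sum>z\<in>{z. D z < 0 \<and> cmod (z - c) \<le> 1}. - D z) < C"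
    and d: "\<exists>C::real. \<forall>c r. r > 1 \<longrightarrow>
              \<bar>integral {1..r} (\<lambda>t. (real_of_int (\<Sum>z\<in>{z. D z > 0 \<and> cmod (z - c) < t}. D z)
                   - real_of_int (\<Sum>z\<in>{z. D z < 0 \<and> cmod (z - c) < t}. - D z)) / t)\<bar> < C"
    and e: "\<exists>C::real. \<forall>c r. r > 1 \<longrightarrow>
              cmod ((1 / complex_of_real r) * integral {1..r} (\<lambda>t.
                  ((\<Sum>z\<in>{z. D z > 0 \<and> cmod (z - c) < t}. of_int (D z) * (z - c))
                 - (\<Sum>z\<in>{z. D z < 0 \<and> cmod (z - c) < t}. of_int (- D z) * (z - c)))
                 / complex_of_real t)) < C"
    and f: "\<exists>L::complex. ((\<lambda>r::real.
               (\<Sum>z\<in>{z. D z > 0 \<and> 1 \<le> cmod z \<and> cmod z < r}. of_int (D z) / z ^ 2)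
             - (\<Sum>z\<in>{z. D z < 0 \<and> 1 \<le> cmod z \<and> cmod z < r}. of_int (- D z) / z ^ 2))
             \<longlongrightarrow> L) at_top"
  shows "\<exists>\<alpha>::complex.
     ((\<lambda>r::real.
          (\<Sum>z\<in>{z. D z < 0 \<and> cmod z < r}. of_int (- D z) * (1 / z - cnj z / complex_of_real (r\<^sup>2)))
        - (\<Sum>z\<in>{z. D z > 0 \<and> cmod z < r}. of_int (D z) * (1 / z - cnj z / complex_of_real (r\<^sup>2))))
        \<longlongrightarrow> \<alpha>) at_top
   \<and> (let Q = (\<lambda>z (r::real).
            (\<Prod>w\<in>{w. D w > 0 \<and> cmod w < r}. ((1 - z / w) * exp (z / w)) ^ nat (D w))
          / (\<Prod>w\<in>{w. D w < 0 \<and> cmod w < r}. ((1 - z / w) * exp (z / w)) ^ nat (- D w)));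
          F = (\<lambda>z. exp (\<alpha> * z) * Lim at_top (Q z))
      in (\<forall>z. D z \<ge> 0 \<longrightarrow> (\<exists>L. (Q z \<longlongrightarrow> L) at_top))
       \<and> meromorphic_with_divisor F D
       \<and> normal_function (\<lambda>z. if D z < 0 then None else Some (F z)))"
proof -
  have fin_le: "finite {z. D z \<noteq> 0 \<and> cmod (z - c) \<le> r}" for c r
  proof (rule finite_subset)
    show "finite {z. D z \<noteq> 0 \<and> cmod z \<le> cmod c + r}" using div by (simp add: is_divisor_def)
    show "{z. D z \<noteq> 0 \<and> cmod (z - c) \<le> r} \<subseteq> {z. D z \<noteq> 0 \<and> cmod z \<le> cmod c + r}"
    proof
      fix z assume "z \<in> {z. D z \<noteq> 0 \<and> cmod (z - c) \<le> r}"
      then show "z \<in> {z. D z \<noteq> 0 \<and> cmod z \<le> cmod c + r}"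
        using norm_triangle_sub[of z c] by auto
    qed
  qed
  have fin: "finite {z. D z \<noteq> 0 \<and> cmod (z - c) < r}" for c r
    by (rule finite_subset[OF _ fin_le[of c r]]) auto
  have fin0: "finite {z. D z \<noteq> 0 \<and> cmod z < r}" for r
    using fin[of 0 r] by simp
  have fin1: "finite {z. D z \<noteq> 0 \<and> 1 \<le> cmod z \<and> cmod z < r}" for r
    by (rule finite_subset[OF _ fin0[of r]]) auto
  obtain Cb where Cb: "\<And>c. real_of_int (\<Sum>z\<in>{z. D z > 0 \<and> cmod (z - c) \<le> 1}. D z)
                        + real_of_int (\<Sum>z\<in>{z. D z < 0 \<and> cmod (z - c) \<le> 1}. - D z) < Cb"
    using b by blast
  obtain Cd where Cd: "\<And>c r. r > 1 \<Longrightarrow>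
              \<bar>integral {1..r} (\<lambda>t. (real_of_int (\<Sum>z\<in>{z. D z > 0 \<and> cmod (z - c) < t}. D z)
                   - real_of_int (\<Sum>z\<in>{z. D z < 0 \<and> cmod (z - c) < t}. - D z)) / t)\<bar> < Cd"
    using d by blast
  obtain Ce where Ce: "\<And>c r. r > 1 \<Longrightarrow>
              cmod ((1 / complex_of_real r) * integral {1..r} (\<lambda>t.
                  ((\<Sum>z\<in>{z. D z > 0 \<and> cmod (z - c) < t}. of_int (D z) * (z - c))
                 - (\<Sum>z\<in>{z. D z < 0 \<and> cmod (z - c) < t}. of_int (- D z) * (z - c)))
                 / complex_of_real t)) < Ce"
    using e by blast
  \<comment> \<open>The separate sums over zeros and poles are merged into signed sums, and the
    integrals in (d) and (e) are evaluated to reach the form of the locale.\<close>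
  interpret convergent_divisor D Cb Cd Ce
  proof
    show "finite {w. D w \<noteq> 0 \<and> cmod w \<le> R}" for R using div by (simp add: is_divisor_def)
    show "D 0 = 0" by (rule nonzero)
    show "(\<Sum>w | D w \<noteq> 0 \<and> cmod (w - c) \<le> 1. real_of_int \<bar>D w\<bar>) \<le> Cb" for c
    proof -
      have eq: "{w. D w \<noteq> 0 \<and> cmod (w - c) \<le> 1} = {w. D w > 0 \<and> cmod (w - c) \<le> 1} \<union> {w. D w < 0 \<and> cmod (w - c) \<le> 1}"
        by auto
      have "(\<Sum>w | D w \<noteq> 0 \<and> cmod (w - c) \<le> 1. real_of_int \<bar>D w\<bar>) =
         (\<Sum>w | D w > 0 \<and> cmod (w - c) \<le> 1. real_of_int \<bar>D w\<bar>) + (\<Sum>w | D w < 0 \<and> cmod (w - c) \<le> 1. real_of_int \<bar>D w\<bar>)"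
        unfolding eq by (intro sum.union_disjoint) (auto intro: finite_subset[OF _ fin_le[of c 1]])
      then show ?thesis using Cb[of c] by simp
    qed
    show "\<bar>\<Sum>w | D w \<noteq> 0 \<and> cmod (w - c) < r. of_int (D w) * log_cutoff r (cmod (w - c))\<bar> \<le> Cd" if "1 < r" for c r
    proof -
      have "real_of_int (\<Sum>z\<in>{z. D z > 0 \<and> cmod (z - c) < t}. D z) - real_of_int (\<Sum>z\<in>{z. D z < 0 \<and> cmod (z - c) < t}. - D z)
          = (\<Sum>z | D z \<noteq> 0 \<and> cmod (z - c) < t. of_int (D z))" for t
        using sum_positive_minus_negative[OF fin[of c t], of "\<lambda>_. 1::real"] by simp
      then have "\<bar>integral {1..r} (\<lambda>t. (\<Sum>z | D z \<noteq> 0 \<and> cmod (z - c) < t. real_of_int (D z)) / t)\<bar> < Cd"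
        using Cd[OF that, of c] by simp
      moreover have "((\<lambda>t. (\<Sum>z | D z \<noteq> 0 \<and> cmod (z - c) < t. real_of_int (D z)) / t) has_integral
          (\<Sum>w | D w \<noteq> 0 \<and> cmod (w - c) < r. of_int (D w) * log_cutoff r (cmod (w - c)))) {1..r}"
        using has_integral_linear[OF has_integral_radial_sum[OF fin that, where g = "\<lambda>_. 1"] bounded_linear_Re]
        by (simp add: o_def Re_divide_of_real)
      ultimately show ?thesis by (simp add: integral_unique)
    qed
    show "cmod (\<Sum>w | D w \<noteq> 0 \<and> cmod (w - c) < r. of_int (D w) * (w - c) * of_real (log_cutoff r (cmod (w - c)))) \<le> Ce * r"
      if "1 < r" for c r
    proof -
      have "cmod ((1 / complex_of_real r) * integral {1..r} (\<lambda>t. (\<Sum>z | D z \<noteq> 0 \<and> cmod (z - c) < t. of_int (D z) * (z - c)) / of_real t)) < Ce"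
        using Ce[OF that, of c] by (simp only: sum_positive_minus_negative[OF fin])
      then have "cmod (\<Sum>w | D w \<noteq> 0 \<and> cmod (w - c) < r. of_int (D w) * (w - c) * of_real (log_cutoff r (cmod (w - c)))) / r < Ce"
        using that unfolding integral_unique[OF has_integral_radial_sum[OF fin that]]
        by (simp add: norm_mult norm_divide)
      then show ?thesis using that by (simp add: divide_less_eq)
    qed
    show "\<exists>L. ((\<lambda>r. \<Sum>w | D w \<noteq> 0 \<and> 1 \<le> cmod w \<and> cmod w < r. of_int (D w) / w\<^sup>2) \<longlongrightarrow> L) at_top"
      using f unfolding divide_inverse by (simp only: sum_positive_minus_negative[OF fin1])
  qed
  have disc0: "disc 0 r = {z. D z \<noteq> 0 \<and> cmod z < r}" for r by (simp add: disc_def)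
  obtain L where "(drift \<longlongrightarrow> L) at_top" using drift_converges by blast
  \<comment> \<open>The theorem subtracts zeros from poles, \<open>drift\<close> poles from zeros;
    hence the sign.\<close>
  define \<alpha> where "\<alpha> = - L"
  with \<open>(drift \<longlongrightarrow> L) at_top\<close> have \<alpha>: "(drift \<longlongrightarrow> - \<alpha>) at_top" by simp
  have drift: "(\<Sum>z\<in>{z. D z < 0 \<and> cmod z < r}. of_int (- D z) * (1 / z - cnj z / complex_of_real (r\<^sup>2)))
        - (\<Sum>z\<in>{z. D z > 0 \<and> cmod z < r}. of_int (D z) * (1 / z - cnj z / complex_of_real (r\<^sup>2))) = - drift r" for r
    unfolding drift_def disc0 sum_positive_minus_negative[OF fin0, symmetric] by simp
  define Q where "Q = (\<lambda>z (r::real).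
            (\<Prod>w\<in>{w. D w > 0 \<and> cmod w < r}. ((1 - z / w) * exp (z / w)) ^ nat (D w))
          / (\<Prod>w\<in>{w. D w < 0 \<and> cmod w < r}. ((1 - z / w) * exp (z / w)) ^ nat (- D w)))"
  \<comment> \<open>Negative integer powers turn the quotient into a single product. When a pole
    factor vanishes at z both sides are 0 by the conventions for division, so the identity holds at
    poles as well.\<close>
  have Q: "Q z = (\<lambda>r. partial_product (disc 0 r) z)" for z
  proof
    fix r
    have eq: "disc 0 r = {w. D w > 0 \<and> cmod w < r} \<union> {w. D w < 0 \<and> cmod w < r}"
      by (auto simp: disc0)
    have "partial_product (disc 0 r) z = (\<Prod>w | D w > 0 \<and> cmod w < r. elementary_factor w z powi D w) *
        (\<Prod>w | D w < 0 \<and> cmod w < r. elementary_factor w z powi D w)"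
      unfolding partial_product_def eq
      by (intro prod.union_disjoint) (auto intro: finite_subset[OF _ fin0[of r]])
    also have "(\<Prod>w | D w > 0 \<and> cmod w < r. elementary_factor w z powi D w) =
        (\<Prod>w | D w > 0 \<and> cmod w < r. ((1 - z / w) * exp (z / w)) ^ nat (D w))"
      by (intro prod.cong) (auto simp: power_int_def elementary_factor_def)
    also have "(\<Prod>w | D w < 0 \<and> cmod w < r. elementary_factor w z powi D w) =
        inverse (\<Prod>w | D w < 0 \<and> cmod w < r. ((1 - z / w) * exp (z / w)) ^ nat (- D w))"
      unfolding prod_inversef[symmetric] o_def
      by (intro prod.cong) (auto simp: power_int_def elementary_factor_def simp flip: power_inverse)
    finally show "Q z r = partial_product (disc 0 r) z"
      by (simp add: Q_def divide_inverse)
  qed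
  have F: "(\<lambda>z. exp (\<alpha> * z) * Lim at_top (Q z)) = limit_function \<alpha>"
    by (simp add: limit_function_def Q fun_eq_iff)
  obtain \<delta> where \<delta>: "0 < \<delta>" "\<And>x y. 0 < D x \<Longrightarrow> D y < 0 \<Longrightarrow> \<delta> \<le> cmod (x - y)"
    using a by blast
  show ?thesis
    unfolding drift Q_def[symmetric] Let_def
  proof (intro exI conjI)
    show "((\<lambda>r. - drift r) \<longlongrightarrow> \<alpha>) at_top" using tendsto_minus[OF \<alpha>] by simp
    show "\<forall>z. 0 \<le> D z \<longrightarrow> (\<exists>L. (Q z \<longlongrightarrow> L) at_top)"
      unfolding Q using partial_product_tendsto by blast
    show "meromorphic_with_divisor (\<lambda>z. exp (\<alpha> * z) * Lim at_top (Q z)) D"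
      unfolding F by (rule limit_function_meromorphic)
    show "normal_function (\<lambda>z. if D z < 0 then None else Some (exp (\<alpha> * z) * Lim at_top (Q z)))"
      using limit_function_normal[OF \<alpha> \<delta>] unfolding F[symmetric] .
  qed
qed

end
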